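(* Let $\nu=e^{-f}$ on $\mathbb{R}^n$ with $\|\nabla^2 f\|_{\mathrm{op}}\le L$ everywhere, let $0<\epsilon<\min\{\frac1L,\frac{1}{2\beta}\}$, and suppose the biased limit $\nu_\epsilon$ of PLA with step size $\epsilon$ satisfies the log-Sobolev inequality with constant $\beta>0$. Let $q>1$. Then along PLA with step size $\epsilon$, for all $k\ge0$, \[ R_{q,\nu}(\rho_k) \le \Big(\frac{q-\frac12}{q-1}\Big) R_{2q,\nu_\epsilon}(\rho_0)\, e^{-\frac{\beta\epsilon k}{2q}} + R_{2q-1,\nu}(\nu_\epsilon). \]
   Context: Proximal Langevin Algorithm (PLA) with step size $\epsilon>0$ for $\nu=e^{-f}$: starting from a random $x_0\in\mathbb{R}^n$, set $x_{k+1} = x_k - \epsilon \nabla f(x_{k+1}) + \sqrt{2\epsilon}\, z_k$ with $z_k\sim\mathcal{N}(0,I)$ independent; equivalently $\rho_{k+1} = (I+\epsilon\nabla f)^{-1}_\#\big(\rho_k * \mathcal{N}(0,2\epsilon I)\big)$, where $\rho_k$ is the law of $x_k$ and $T_\#\rho$ is the law of $T(x)$ for $x\sim\rho$. The biased limit $\nu_\epsilon$ is the stationary distribution of PLA, i.e. $\nu_\epsilon = (I+\epsilon\nabla f)^{-1}_\#(\nu_\epsilon * \mathcal{N}(0,2\epsilon I))$ (assumed to exist). Rényi divergence of order $q>0,q\ne1$: $R_{q,\nu}(\rho) = \frac{1}{q-1}\log\int \frac{\rho(x)^q}{\nu(x)^{q-1}}dx$. $\nu$ satisfies the log-Sobolev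 inequality with constant $\beta>0$ if $\int\rho\log\frac{\rho}{\nu}dx\le\frac{1}{2\beta}\int\rho\|\nabla\log\frac{\rho}{\nu}\|^2dx$ for all $\rho$. Densities are assumed smooth. *)

theory Defs
  imports "HOL-Analysis.Analysis"
begin

definition prob_density :: "('a::euclidean_space \<Rightarrow> real) \<Rightarrow> bool" where
  "prob_density \<rho> \<longleftrightarrow> \<rho> \<in> borel_measurable lborel \<and> (\<forall>x. 0 \<le> \<rho> x) \<and>
     (\<integral>\<^sup>+ x. ennreal (\<rho> x) \<partial>lborel) = 1"

definition gauss_2eps :: "real \<Rightarrow> 'a::euclidean_space \<Rightarrow> real" where
  "gauss_2eps eps y = (4 * pi * eps) powr (- real DIM('a) / 2) * exp (- (norm y)\<^sup>2 / (4 * eps))"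

definition conv_gauss :: "real \<Rightarrow> ('a::euclidean_space \<Rightarrow> real) \<Rightarrow> 'a \<Rightarrow> real" where
  "conv_gauss eps \<rho> y = (\<integral> x. \<rho> x * gauss_2eps eps (y - x) \<partial>lborel)"

definition prox_map :: "real \<Rightarrow> ('a::euclidean_space \<Rightarrow> 'a) \<Rightarrow> 'a \<Rightarrow> 'a" where
  "prox_map eps gradf = inv (\<lambda>x. x + eps *\<^sub>R gradf x)"

definition PLA_step :: "real \<Rightarrow> ('a::euclidean_space \<Rightarrow> 'a) \<Rightarrow> ('a \<Rightarrow> real) \<Rightarrow> ('a \<Rightarrow> real) \<Rightarrow> bool" where
  "PLA_step eps gradf \<rho> \<rho>' \<longleftrightarrow>
     density lborel (\<lambda>x. ennreal (\<rho>' x)) =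
     distr (density lborel (\<lambda>y. ennreal (conv_gauss eps \<rho> y))) lborel (prox_map eps gradf)"

definition renyi :: "real \<Rightarrow> ('a::euclidean_space \<Rightarrow> real) \<Rightarrow> ('a \<Rightarrow> real) \<Rightarrow> ereal" where
  "renyi q \<nu> \<rho> =
     (let I = (\<integral>\<^sup>+ x. ennreal (\<rho> x powr q / \<nu> x powr (q - 1)) \<partial>lborel)
      in if I = \<infinity> then (if q > 1 then \<infinity> else -\<infinity>)
         else ereal (1 / (q - 1) * ln (enn2real I)))"

definition KL :: "('a::euclidean_space \<Rightarrow> real) \<Rightarrow> ('a \<Rightarrow> real) \<Rightarrow> real" where
  "KL \<nu> \<rho> = (\<integral> x. \<rho> x * ln (\<rho> x / \<nu> x) \<partial>lborel)"

definition LSI :: "('a::euclidean_space \<Rightarrow> real) \<Rightarrow> real \<Rightarrow> bool" where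
  "LSI \<nu> \<beta> \<longleftrightarrow>
     (\<forall>\<rho> g. prob_density \<rho> \<longrightarrow> (\<forall>x. 0 < \<rho> x) \<longrightarrow>
        (\<forall>x. GDERIV (\<lambda>y. ln (\<rho> y / \<nu> y)) x :> g x) \<longrightarrow>
        integrable lborel (\<lambda>x. \<rho> x * ln (\<rho> x / \<nu> x)) \<longrightarrow>
        ennreal (KL \<nu> \<rho>) \<le> ennreal (1 / (2 * \<beta>)) * (\<integral>\<^sup>+ x. ennreal (\<rho> x * (norm (g x))\<^sup>2) \<partial>lborel))"

end

theory Submission
  imports Defs "HOL-Probability.Distributions"
begin

text \<open>
  By Cauchy--Schwarz the claim reduces to a contraction of the order \<open>r = 2q\<close> divergence
  to \<open>\<nu>\<epsilon>\<close> in each step. The proximal map is a bijection and leaves divergences unchanged, so only the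
  convolution with the Gaussian kernel \<open>P\<close> matters. Writing \<open>h\<close> for the density of \<open>\<rho>\<close> relative to \<open>\<nu>\<epsilon>\<close>,
  duality and Hoelder's inequality turn the contraction into hypercontractivity of \<open>P\<close> from \<open>L\<^sup>a\<close> of the
  smoothed measure to \<open>L\<^sup>b(\<nu>\<epsilon>)\<close>, where \<open>a\<close> is conjugate to \<open>r\<close> and \<open>b = a + 2\<beta>\<epsilon>(a - 1)\<close>.

  Hypercontractivity needs no heat flow: the functions \<open>V\<^sub>\<alpha> = ln (P k\<^sup>\<alpha>) / \<alpha>\<close>, \<open>1 \<le> \<alpha> \<le> a\<close>, are smooth, and the
  reverse local log-Sobolev inequality of the Gaussian says exactly that \<open>\<epsilon> |\<nabla>V\<^sub>\<alpha>|\<^sup>2 \<le> \<partial>V\<^sub>\<alpha>/\<partial>\<alpha>\<close>. Applying the log-Sobolev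
  inequality of \<open>\<nu>\<epsilon>\<close> to \<open>exp (b(\<alpha>) V\<^sub>\<alpha>)\<close> then shows that its normalised norm is monotone in \<open>\<alpha>\<close>.
\<close>

section \<open>Integral inequalities and differentiation under the integral\<close>

text \<open>Dominated convergence for the remainder quotient of the derivative at \<open>x0\<close>,
  along sequences. Domination is phrased through increments from \<open>x0\<close>, which is the
  form in which the Gaussian kernel is estimated later.\<close>

lemma GDERIV_integral:
  fixes F :: "'b::euclidean_space \<Rightarrow> 'a \<Rightarrow> real" and D :: "'a \<Rightarrow> 'b"
  assumes r: "0 < r"
    and int: "\<And>x. x \<in> ball x0 r \<Longrightarrow> integrable M (F x)"
    and deriv: "\<And>y. GDERIV (\<lambda>x. F x y) x0 :> D y"
    and lip: "\<And>x y. x \<in> ball x0 r \<Longrightarrow> \<bar>F x y - F x0 y\<bar> \<le> B y * norm (x - x0)"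
    and D_le: "\<And>y. norm (D y) \<le> B y"
    and D_meas [measurable]: "D \<in> borel_measurable M"
    and B: "integrable M B"
  shows "GDERIV (\<lambda>x. \<integral>y. F x y \<partial>M) x0 :> (\<integral>y. D y \<partial>M)"
proof -
  have x0: "x0 \<in> ball x0 r" using r by simp
  have B_nonneg: "0 \<le> B y" for y using D_le[of y] norm_ge_zero[of "D y"] by linarith
  have intD: "integrable M D"
    by (rule Bochner_Integration.integrable_bound[OF B]) (use D_le B_nonneg in auto)
  let ?q = "\<lambda>x y. (F x y - F x0 y - inner (x - x0) (D y)) / norm (x - x0)"
  have "((\<lambda>x. norm ((\<integral>y. F x y \<partial>M) - (\<integral>y. F x0 y \<partial>M) - inner (x - x0) (\<integral>y. D y \<partial>M)) / norm (x - x0)) \<longlongrightarrow> 0)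
    (at x0 within ball x0 r)"
    unfolding tendsto_at_iff_sequentially
  proof (intro allI impI)
    fix X :: "nat \<Rightarrow> 'b"
    assume X: "\<forall>i. X i \<in> ball x0 r - {x0}" and lim: "X \<longlonglongrightarrow> x0"
    have Xb: "X i \<in> ball x0 r" and Xne: "X i \<noteq> x0" for i using X by auto
    have meas[measurable]: "F (X i) \<in> borel_measurable M" "F x0 \<in> borel_measurable M" for i
      using int[OF Xb] int[OF x0] by auto
    \<comment> \<open>In the dominating function \<open>2 * B y\<close>, one \<open>B y\<close> pays
      for the increment and one for the linear term, by Cauchy-Schwarz.\<close>
    have "(\<lambda>i. \<integral>y. ?q (X i) y \<partial>M) \<longlonglongrightarrow> (\<integral>y. 0 \<partial>M)"
    proof (rule integral_dominated_convergence[where w="\<lambda>y. 2 * B y"])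
      show "AE y in M. (\<lambda>i. ?q (X i) y) \<longlonglongrightarrow> 0"
      proof (rule AE_I2)
        fix y
        have "((\<lambda>x. norm (F x y - F x0 y - inner (x - x0) (D y)) / norm (x - x0)) \<longlongrightarrow> 0) (at x0)"
          using deriv[of y] unfolding gderiv_def has_derivative_iff_norm by simp
        then have "(\<lambda>i. norm (?q (X i) y)) \<longlonglongrightarrow> 0"
          using lim Xne unfolding tendsto_at_iff_sequentially by (auto simp: o_def)
        then show "(\<lambda>i. ?q (X i) y) \<longlonglongrightarrow> 0" by (rule tendsto_norm_zero_cancel)
      qed
      fix i
      show "AE y in M. norm (?q (X i) y) \<le> 2 * B y"
      proof (rule AE_I2)
        fix y
        have "\<bar>inner (X i - x0) (D y)\<bar> \<le> B y * norm (X i - x0)"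
          by (rule order_trans[OF Cauchy_Schwarz_ineq2]) (simp add: D_le mult_right_mono mult.commute)
        with lip[OF Xb, of i y] have "\<bar>F (X i) y - F x0 y - inner (X i - x0) (D y)\<bar> \<le> 2 * (B y * norm (X i - x0))"
          by linarith
        then show "norm (?q (X i) y) \<le> 2 * B y"
          using Xne[of i] by (simp add: abs_div pos_divide_le_eq mult.assoc)
      qed
    qed (use B in auto)
    then have "(\<lambda>i. norm (\<integral>y. ?q (X i) y \<partial>M)) \<longlonglongrightarrow> 0"
      by (intro tendsto_norm_zero) simp
    moreover have "(\<integral>y. ?q (X i) y \<partial>M) = ((\<integral>y. F (X i) y \<partial>M) - (\<integral>y. F x0 y \<partial>M) - inner (X i - x0) (\<integral>y. D y \<partial>M)) / norm (X i - x0)" for i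
      using int[OF Xb] int[OF x0] intD by simp
    ultimately show "((\<lambda>x. norm ((\<integral>y. F x y \<partial>M) - (\<integral>y. F x0 y \<partial>M) - inner (x - x0) (\<integral>y. D y \<partial>M)) / norm (x - x0)) \<circ> X) \<longlonglongrightarrow> 0"
      by (simp only: o_def real_norm_def abs_divide abs_norm_cancel)
  qed
  then have "((\<lambda>x. norm ((\<integral>y. F x y \<partial>M) - (\<integral>y. F x0 y \<partial>M) - inner (x - x0) (\<integral>y. D y \<partial>M)) / norm (x - x0)) \<longlongrightarrow> 0) (at x0)"
    using at_within_open[OF x0 open_ball] by simp
  then show ?thesis
    unfolding gderiv_def has_derivative_iff_norm by (simp add: bounded_linear_inner_left)
qed

text \<open>For a real parameter, a bound on the derivative over a ball yields the increment bound
  by the mean value inequality.\<close>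

lemma has_real_derivative_integral:
  fixes F F' :: "real \<Rightarrow> 'a \<Rightarrow> real"
  assumes r: "0 < r"
    and int: "\<And>t. t \<in> ball t0 r \<Longrightarrow> integrable M (F t)"
    and deriv: "\<And>t y. t \<in> ball t0 r \<Longrightarrow> ((\<lambda>t. F t y) has_real_derivative F' t y) (at t)"
    and bound: "\<And>t y. t \<in> ball t0 r \<Longrightarrow> \<bar>F' t y\<bar> \<le> B y"
    and meas: "F' t0 \<in> borel_measurable M"
    and B: "integrable M B"
  shows "((\<lambda>t. \<integral>y. F t y \<partial>M) has_real_derivative (\<integral>y. F' t0 y \<partial>M)) (at t0)"
proof -
  have t0: "t0 \<in> ball t0 r" using r by simp
  have "\<bar>F t y - F t0 y\<bar> \<le> B y * norm (t - t0)" if "t \<in> ball t0 r" for t y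
    using field_differentiable_bound[of "ball t0 r" "\<lambda>t. F t y" "\<lambda>t. F' t y" "B y" t t0]
      deriv bound that t0 by (auto simp: has_field_derivative_at_within)
  then have "GDERIV (\<lambda>t. \<integral>y. F t y \<partial>M) t0 :> (\<integral>y. F' t0 y \<partial>M)"
    by (intro GDERIV_integral[OF r int _ _ _ meas B]) (use deriv[OF t0] bound[OF t0] in auto)
  then show ?thesis by simp
qed

text \<open>Young's inequality with weights \<theta> and 1 - \<theta> gives integrability, and the
  bound follows once both factors are normalised to integral 1. Exponents are kept inside the
  integrand so that later uses interpolate between powers of densities by plain rewriting.\<close>

lemma Holder_integral:
  fixes f g :: "'a \<Rightarrow> real"
  assumes \<theta>: "0 < \<theta>" "\<theta> < 1"
    and f: "integrable M f" "\<And>x. 0 \<le> f x" and g: "integrable M g" "\<And>x. 0 \<le> g x"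
  shows "integrable M (\<lambda>x. f x powr \<theta> * g x powr (1 - \<theta>))" (is "integrable M ?h")
    and "(\<integral>x. f x powr \<theta> * g x powr (1 - \<theta>) \<partial>M) \<le> (\<integral>x. f x \<partial>M) powr \<theta> * (\<integral>x. g x \<partial>M) powr (1 - \<theta>)"
proof -
  have young: "a powr \<theta> * b powr (1 - \<theta>) \<le> \<theta> * a + (1 - \<theta>) * b" if "0 \<le> a" "0 \<le> b" for a b :: real
  proof (cases "a = 0 \<or> b = 0")
    case False
    then show ?thesis using Youngs_inequality_0[of \<theta> "1 - \<theta>" a b] that \<theta> by auto
  qed (use that \<theta> in auto)
  have [measurable]: "f \<in> borel_measurable M" "g \<in> borel_measurable M" using f g by auto
  show int: "integrable M ?h"
  proof (rule Bochner_Integration.integrable_bound)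
    show "integrable M (\<lambda>x. \<theta> * f x + (1 - \<theta>) * g x)" using f g by auto
    show "AE x in M. norm (?h x) \<le> norm (\<theta> * f x + (1 - \<theta>) * g x)"
      using young[OF f(2) g(2)] by (auto intro!: AE_I2 order_trans[OF _ abs_ge_self])
  qed measurable
  define F G where "F = (\<integral>x. f x \<partial>M)" and "G = (\<integral>x. g x \<partial>M)"
  have FG: "0 \<le> F" "0 \<le> G" unfolding F_def G_def using f g by auto
  show "(\<integral>x. f x powr \<theta> * g x powr (1 - \<theta>) \<partial>M) \<le> (\<integral>x. f x \<partial>M) powr \<theta> * (\<integral>x. g x \<partial>M) powr (1 - \<theta>)"
  proof (cases "F = 0 \<or> G = 0")
    \<comment> \<open>Normalising by the integrals is impossible here, but the product vanishes
      almost everywhere.\<close>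
    case True
    then have "AE x in M. f x = 0 \<or> g x = 0"
      using integral_nonneg_eq_0_iff_AE[of M f] integral_nonneg_eq_0_iff_AE[of M g] f g
      unfolding F_def G_def by auto
    then have "(\<integral>x. ?h x \<partial>M) = (\<integral>x. 0 \<partial>M)"
      by (intro integral_cong_AE) (use \<theta> in auto)
    then show ?thesis by simp
  next
    case False
    then have pos: "0 < F" "0 < G" using FG by auto
    have "?h x \<le> F powr \<theta> * G powr (1 - \<theta>) * (\<theta> * (f x / F) + (1 - \<theta>) * (g x / G))" for x
    proof -
      have "?h x = F powr \<theta> * G powr (1 - \<theta>) * ((f x / F) powr \<theta> * (g x / G) powr (1 - \<theta>))"
        using pos f(2)[of x] g(2)[of x] by (simp add: powr_divide)
      also have "\<dots> \<le> F powr \<theta> * G powr (1 - \<theta>) * (\<theta> * (f x / F) + (1 - \<theta>) * (g x / G))"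
        using young[of "f x / F" "g x / G"] pos f(2)[of x] g(2)[of x] by (intro mult_left_mono) auto
      finally show ?thesis .
    qed
    then have "(\<integral>x. ?h x \<partial>M) \<le> (\<integral>x. F powr \<theta> * G powr (1 - \<theta>) * (\<theta> * (f x / F) + (1 - \<theta>) * (g x / G)) \<partial>M)"
      by (intro integral_mono int) (use f g in auto)
    also have "\<dots> = F powr \<theta> * G powr (1 - \<theta>) * (\<theta> * (F / F) + (1 - \<theta>) * (G / G))"
      unfolding F_def G_def using f g by simp
    also have "\<dots> = F powr \<theta> * G powr (1 - \<theta>)" using pos by simp
    finally show ?thesis unfolding F_def G_def .
  qed
qed

section \<open>The Gaussian kernel\<close>

lemma gauss_2eps_pos: "0 < eps \<Longrightarrow> 0 < gauss_2eps eps y"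
  by (simp add: gauss_2eps_def)

lemma borel_measurable_gauss_2eps [measurable]: "gauss_2eps eps \<in> borel_measurable borel"
  unfolding gauss_2eps_def[abs_def] by measurable

lemma gauss_2eps_minus: "gauss_2eps eps (x - y) = gauss_2eps eps (y - x)"
  by (simp add: gauss_2eps_def norm_minus_commute)

text \<open>The kernel is the density of N(0, 2 eps I), so it splits into one-dimensional normal
  densities of standard deviation \<open>sqrt (2 * eps)\<close>; its normalisation thereby reduces
  to dimension one.\<close>

lemma gauss_2eps_eq_prod:
  fixes y :: "'a::euclidean_space"
  assumes "0 < eps"
  shows "gauss_2eps eps y = (\<Prod>b\<in>Basis. normal_density 0 (sqrt (2 * eps)) (y \<bullet> b))"
proof -
  have "(\<Prod>b\<in>Basis. normal_density 0 (sqrt (2 * eps)) (y \<bullet> b))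
      = (\<Prod>b\<in>(Basis::'a set). (4 * pi * eps) powr (- 1 / 2) * exp (- (y \<bullet> b)\<^sup>2 / (4 * eps)))"
    using assms by (intro prod.cong) (auto simp: normal_density_def powr_minus powr_half_sqrt field_simps)
  also have "\<dots> = ((4 * pi * eps) powr (- 1 / 2)) ^ DIM('a) * exp (\<Sum>b\<in>Basis. - (y \<bullet> b)\<^sup>2 / (4 * eps))"
    by (simp add: prod.distrib exp_sum)
  also have "(\<Sum>b\<in>Basis. - (y \<bullet> b)\<^sup>2 / (4 * eps)) = - (norm y)\<^sup>2 / (4 * eps)"
    by (subst power2_norm_eq_inner, subst euclidean_inner)
      (simp add: sum_divide_distrib sum_negf power2_eq_square)
  also have "((4 * pi * eps) powr (- 1 / 2)) ^ DIM('a) = (4 * pi * eps) powr (- real DIM('a) / 2)"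
    using assms by (simp add: powr_powr flip: powr_realpow)
  finally show ?thesis by (simp add: gauss_2eps_def)
qed

lemma nn_integral_gauss_2eps:
  assumes "0 < eps"
  shows "(\<integral>\<^sup>+ y. ennreal (gauss_2eps eps (y::'a::euclidean_space)) \<partial>lborel) = 1"
proof -
  have "(\<integral>\<^sup>+ t. ennreal (normal_density 0 (sqrt (2 * eps)) t) \<partial>lborel) = 1"
    using assms integral_normal_density[of "sqrt (2 * eps)" 0]
    by (subst nn_integral_eq_integral) auto
  then show ?thesis
    using nn_integral_lborel_prod[of "\<lambda>_::'a. normal_density 0 (sqrt (2 * eps))"] assms
    by (simp add: gauss_2eps_eq_prod prod_ennreal)
qed

lemma
  fixes x :: "'a::euclidean_space"
  assumes "0 < eps"
  shows nn_integral_gauss_2eps_shift: "(\<integral>\<^sup>+ y. ennreal (gauss_2eps eps (x - y)) \<partial>lborel) = 1"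
    and integrable_gauss_2eps_shift: "integrable lborel (\<lambda>y. gauss_2eps eps (x - y))"
    and integral_gauss_2eps_shift: "(\<integral>y. gauss_2eps eps (x - y) \<partial>lborel) = 1"
proof -
  have "1 = (\<integral>\<^sup>+ y. ennreal (gauss_2eps eps y) \<partial>distr lborel borel ((+) (- x)))"
    unfolding lborel_distr_plus using nn_integral_gauss_2eps[OF assms] by simp
  also have "\<dots> = (\<integral>\<^sup>+ y. ennreal (gauss_2eps eps (x - y)) \<partial>lborel)"
    by (subst nn_integral_distr) (auto simp: gauss_2eps_minus[of eps x])
  finally show 1: "(\<integral>\<^sup>+ y. ennreal (gauss_2eps eps (x - y)) \<partial>lborel) = 1" by simp
  show 2: "integrable lborel (\<lambda>y. gauss_2eps eps (x - y))"
    by (rule integrableI_nonneg) (auto simp: 1 gauss_2eps_pos[OF assms] less_imp_le)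
  show "(\<integral>y. gauss_2eps eps (x - y) \<partial>lborel) = 1"
    by (subst integral_eq_nn_integral) (auto simp: 1 gauss_2eps_pos[OF assms] less_imp_le)
qed

lemma integrable_conv_gauss:
  fixes f :: "'a::euclidean_space \<Rightarrow> real"
  assumes "0 < eps" and [measurable]: "f \<in> borel_measurable borel" and "\<And>y. \<bar>f y\<bar> \<le> C"
  shows "integrable lborel (\<lambda>y. f y * gauss_2eps eps (x - y))"
proof (rule Bochner_Integration.integrable_bound)
  show "integrable lborel (\<lambda>y. C * gauss_2eps eps (x - y))"
    using integrable_gauss_2eps_shift[OF assms(1), of x] by simp
  show "AE y in lborel. norm (f y * gauss_2eps eps (x - y)) \<le> norm (C * gauss_2eps eps (x - y))"
    using assms(3) by (auto simp: abs_mult gauss_2eps_pos[OF assms(1)] less_imp_le intro!: AE_I2 mult_right_mono order_trans[OF _ abs_ge_self])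
qed measurable

lemma borel_measurable_conv_gauss [measurable]:
  fixes f :: "'a::euclidean_space \<Rightarrow> real"
  assumes [measurable]: "f \<in> borel_measurable borel"
  shows "conv_gauss eps f \<in> borel_measurable borel"
  unfolding conv_gauss_def[abs_def] by measurable

lemma conv_gauss_mono:
  fixes f g :: "'a::euclidean_space \<Rightarrow> real"
  assumes "0 < eps" and [measurable]: "f \<in> borel_measurable borel" "g \<in> borel_measurable borel"
    and "\<And>y. \<bar>f y\<bar> \<le> C" "\<And>y. \<bar>g y\<bar> \<le> C'" and "\<And>y. f y \<le> g y"
  shows "conv_gauss eps f x \<le> conv_gauss eps g x"
  unfolding conv_gauss_def using assms
  by (intro integral_mono integrable_conv_gauss)
     (auto intro!: mult_right_mono simp: gauss_2eps_pos less_imp_le)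

lemma conv_gauss_const:
  fixes x :: "'a::euclidean_space"
  shows "0 < eps \<Longrightarrow> conv_gauss eps (\<lambda>_. c) x = c"
  by (simp add: conv_gauss_def integral_gauss_2eps_shift)

lemma conv_gauss_cmult: "conv_gauss eps (\<lambda>y. c * f y) x = c * conv_gauss eps f x"
  by (simp add: conv_gauss_def mult.assoc)

section \<open>Gradient of the Gaussian smoothing and the reverse local log-Sobolev
  inequality\<close>

definition grad_conv_gauss :: "real \<Rightarrow> ('a::euclidean_space \<Rightarrow> real) \<Rightarrow> 'a \<Rightarrow> 'a" where
  "grad_conv_gauss eps f x = (\<integral>y. (f y * gauss_2eps eps (x - y) / (2 * eps)) *\<^sub>R (y - x) \<partial>lborel)"

text \<open>Supplies the dominating function for differentiating a convolution. A shift by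
  \<open>h\<close> multiplies the kernel by an exponential that is at most linear in
  \<open>norm z\<close> in the exponent; doubling the variance frees half of the Gaussian decay,
  which absorbs it.\<close>

lemma gauss_2eps_increment:
  assumes "0 < eps"
  obtains A where "0 \<le> A"
    "\<And>z::'a::euclidean_space. norm z / (2 * eps) * gauss_2eps eps z \<le> A * gauss_2eps (2 * eps) z"
    "\<And>z h::'a. norm h \<le> 1 \<Longrightarrow> \<bar>gauss_2eps eps (z + h) - gauss_2eps eps z\<bar> \<le> A * gauss_2eps (2 * eps) z * norm h"
proof
  let ?n = "- real DIM('a) / 2"
  let ?A = "exp (5 / (2 * eps)) * (4 * pi * eps) powr ?n / (8 * pi * eps) powr ?n"
  \<comment> \<open>\<open>w z\<close> bounds the change of the exponent
    \<open>(norm z)\<^sup>2 / (4 * eps)\<close> per unit length of a shift of norm at most 1; it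
    also bounds the logarithmic gradient of the kernel.\<close>
  define w where "w z = (2 * norm z + 1) / (4 * eps)" for z :: 'a
  have w: "0 \<le> w z" "norm z / (2 * eps) \<le> w z" for z
    using assms by (auto simp: w_def field_simps)
  have we: "w z * exp (w z) \<le> exp (2 * w z)" "w z \<le> exp (2 * w z)" for z
  proof -
    have "w z \<le> exp (w z)" using exp_ge_add_one_self[of "w z"] by linarith
    then have "w z * exp (w z) \<le> exp (w z) * exp (w z)" by (rule mult_right_mono) simp
    then show "w z * exp (w z) \<le> exp (2 * w z)" by (metis exp_add mult_2)
    then show "w z \<le> exp (2 * w z)"
      using mult_left_mono[of 1 "exp (w z)" "w z"] w[of z] by simp
  qed
  have main: "exp (2 * w z) * gauss_2eps eps z \<le> ?A * gauss_2eps (2 * eps) z" for z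
  proof -
    have "2 * w z - (norm z)\<^sup>2 / (4 * eps) \<le> 5 / (2 * eps) - (norm z)\<^sup>2 / (8 * eps)"
    proof -
      \<comment> \<open>Over the denominator \<open>8 * eps\<close> the linear term is
        \<open>8 * norm z\<close>. Giving up one of the two quadratic terms and completing the
        square leaves 4 + 16 = 20, hence the constant \<open>5 / (2 * eps)\<close>.\<close>
      have "0 \<le> (norm z - 4)\<^sup>2" by simp
      then have "8 * norm z + 4 - 2 * (norm z)\<^sup>2 \<le> 20 - (norm z)\<^sup>2" by (simp add: power2_diff)
      then have "(8 * norm z + 4 - 2 * (norm z)\<^sup>2) / (8 * eps) \<le> (20 - (norm z)\<^sup>2) / (8 * eps)"
        using assms by (intro divide_right_mono) auto
      moreover have "2 * w z - (norm z)\<^sup>2 / (4 * eps) = (8 * norm z + 4 - 2 * (norm z)\<^sup>2) / (8 * eps)"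
        using assms by (simp add: w_def field_simps)
      moreover have "5 / (2 * eps) - (norm z)\<^sup>2 / (8 * eps) = (20 - (norm z)\<^sup>2) / (8 * eps)"
        using assms by (simp add: field_simps)
      ultimately show ?thesis by simp
    qed
    then have "exp (2 * w z) * exp (- (norm z)\<^sup>2 / (4 * eps)) \<le> exp (5 / (2 * eps)) * exp (- (norm z)\<^sup>2 / (8 * eps))"
      by (simp flip: exp_add)
    then show ?thesis using assms by (simp add: gauss_2eps_def mult_ac)
  qed
  show "0 \<le> ?A" by simp
  show "norm z / (2 * eps) * gauss_2eps eps z \<le> ?A * gauss_2eps (2 * eps) z" for z :: 'a
    using order_trans[OF mult_right_mono main] w(2)[of z] we(2)[of z] gauss_2eps_pos[OF assms, of z]
    by (meson less_imp_le order_trans)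
  fix z h :: 'a assume h: "norm h \<le> 1"
  \<comment> \<open>Change of the exponent under the shift: the kernel at \<open>z + h\<close> is
    the kernel at \<open>z\<close> times \<open>exp u\<close>. The increment is then controlled by
    |exp u - 1| \<le> |u| exp |u|.\<close>
  define u where "u = - (2 * (z \<bullet> h) + (norm h)\<^sup>2) / (4 * eps)"
  have "\<bar>2 * (z \<bullet> h) + (norm h)\<^sup>2\<bar> \<le> 2 * (norm z * norm h) + norm h * norm h"
    using Cauchy_Schwarz_ineq2[of z h] mult_nonneg_nonneg[OF norm_ge_zero[of h] norm_ge_zero[of h]]
    unfolding power2_eq_square by linarith
  also have "\<dots> \<le> norm h * (2 * norm z + 1)"
    using mult_left_mono[OF h, of "norm h"] by (simp add: algebra_simps)
  finally have u: "\<bar>u\<bar> \<le> w z * norm h"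
    using assms by (simp add: u_def w_def abs_div divide_right_mono mult.commute)
  also have "\<dots> \<le> w z" using h w(1)[of z] by (simp add: mult_left_le)
  finally have u': "\<bar>u\<bar> \<le> w z" .
  have "\<bar>exp u - 1\<bar> \<le> \<bar>u\<bar> * exp \<bar>u\<bar>"
  proof (cases "0 \<le> u")
    case True
    have "1 - u \<le> exp (- u)" using exp_ge_add_one_self[of "- u"] by simp
    then have "(1 - u) * exp u \<le> exp (- u) * exp u" by (rule mult_right_mono) simp
    then show ?thesis using True by (simp add: algebra_simps flip: exp_add)
  next
    case False
    have "1 - exp u \<le> - u * 1" using exp_ge_add_one_self[of u] by linarith
    also have "\<dots> \<le> - u * exp (- u)" using False by (intro mult_left_mono) auto
    finally show ?thesis using False by simp
  qed
  also have "\<dots> \<le> (w z * norm h) * exp (w z)"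
    using u u' w(1)[of z] by (intro mult_mono) auto
  also have "\<dots> \<le> exp (2 * w z) * norm h"
    using mult_right_mono[OF we(1)[of z] norm_ge_zero[of h]] by (simp add: mult_ac)
  finally have *: "\<bar>exp u - 1\<bar> \<le> exp (2 * w z) * norm h" .
  have "gauss_2eps eps (z + h) = gauss_2eps eps z * exp u"
    by (simp add: gauss_2eps_def u_def power2_norm_eq_inner inner_add inner_commute
        add_divide_distrib diff_divide_distrib flip: exp_add)
  then have "gauss_2eps eps (z + h) - gauss_2eps eps z = gauss_2eps eps z * (exp u - 1)"
    by (simp add: right_diff_distrib)
  then have "\<bar>gauss_2eps eps (z + h) - gauss_2eps eps z\<bar> = gauss_2eps eps z * \<bar>exp u - 1\<bar>"
    using gauss_2eps_pos[OF assms, of z] by (simp add: abs_mult)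
  also have "\<dots> \<le> gauss_2eps eps z * (exp (2 * w z) * norm h)"
    using * gauss_2eps_pos[OF assms, of z] by (intro mult_left_mono) auto
  also have "\<dots> \<le> ?A * gauss_2eps (2 * eps) z * norm h"
    using mult_right_mono[OF main[of z] norm_ge_zero[of h]] by (simp add: mult_ac)
  finally show "\<bar>gauss_2eps eps (z + h) - gauss_2eps eps z\<bar> \<le> ?A * gauss_2eps (2 * eps) z * norm h" .
qed

lemma GDERIV_gauss_2eps:
  fixes x y :: "'a::euclidean_space"
  assumes "0 < eps"
  shows "GDERIV (\<lambda>x. gauss_2eps eps (x - y)) x :> (gauss_2eps eps (x - y) / (2 * eps)) *\<^sub>R (y - x)"
  unfolding gderiv_def gauss_2eps_def power2_norm_eq_inner using assms
  by (auto intro!: derivative_eq_intros simp: fun_eq_iff inner_diff inner_commute field_simps)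

text \<open>The derivative falls on the kernel, so boundedness and measurability of \<open>f\<close>
  are the only regularity asked for; the dominating function is a multiple of the kernel with
  parameter \<open>2 * eps\<close>.\<close>

lemma
  fixes f :: "'a::euclidean_space \<Rightarrow> real"
  assumes eps: "0 < eps" and [measurable]: "f \<in> borel_measurable borel" and C: "\<And>y. \<bar>f y\<bar> \<le> C"
  shows integrable_grad_conv_gauss:
      "integrable lborel (\<lambda>y. (f y * gauss_2eps eps (x - y) / (2 * eps)) *\<^sub>R (y - x))" (is ?int)
    and GDERIV_conv_gauss: "GDERIV (conv_gauss eps f) x :> grad_conv_gauss eps f x"
proof -
  obtain A where A: "0 \<le> A"
    "\<And>z::'a. norm z / (2 * eps) * gauss_2eps eps z \<le> A * gauss_2eps (2 * eps) z"
    "\<And>z h::'a. norm h \<le> 1 \<Longrightarrow> \<bar>gauss_2eps eps (z + h) - gauss_2eps eps z\<bar> \<le> A * gauss_2eps (2 * eps) z * norm h"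
    using gauss_2eps_increment[OF eps] by metis
  have C0: "0 \<le> C" using C[of x] by linarith
  let ?B = "\<lambda>y. C * (A * gauss_2eps (2 * eps) (x - y))"
  let ?D = "\<lambda>y. (f y * gauss_2eps eps (x - y) / (2 * eps)) *\<^sub>R (y - x)"
  have B: "integrable lborel ?B"
    using integrable_gauss_2eps_shift[of "2 * eps" x] eps by simp
  have D: "norm (?D y) \<le> ?B y" for y
  proof -
    have "norm (?D y) = \<bar>f y\<bar> * (norm (x - y) / (2 * eps) * gauss_2eps eps (x - y))"
      using eps gauss_2eps_pos[OF eps, of "x - y"] by (simp add: abs_mult norm_minus_commute mult_ac)
    also have "\<dots> \<le> ?B y"
      using C[of y] A(2)[of "x - y"] eps gauss_2eps_pos[OF eps, of "x - y"] C0 by (intro mult_mono[of _ C]) auto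
    finally show ?thesis .
  qed
  show ?int
    by (rule Bochner_Integration.integrable_bound[OF B]) (use D in \<open>auto intro!: AE_I2 order_trans[OF _ abs_ge_self]\<close>)
  have "GDERIV (\<lambda>x. \<integral>y. f y * gauss_2eps eps (x - y) \<partial>lborel) x :> (\<integral>y. ?D y \<partial>lborel)"
  proof (rule GDERIV_integral[where r=1 and B="?B"])
    show "integrable lborel (\<lambda>y. f y * gauss_2eps eps (x' - y))" for x'
      by (rule integrable_conv_gauss[OF eps _ C]) measurable
    show "GDERIV (\<lambda>x. f y * gauss_2eps eps (x - y)) x :> ?D y" for y
      using GDERIV_mult[OF GDERIV_const GDERIV_gauss_2eps[OF eps, of y x], of "f y"] by simp
    show "\<bar>f y * gauss_2eps eps (x' - y) - f y * gauss_2eps eps (x - y)\<bar> \<le> ?B y * norm (x' - x)"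
      if "x' \<in> ball x 1" for x' y
    proof -
      have "\<bar>gauss_2eps eps (x' - y) - gauss_2eps eps (x - y)\<bar> \<le> A * gauss_2eps (2 * eps) (x - y) * norm (x' - x)"
        using A(3)[of "x' - x" "x - y"] that by (simp add: dist_norm norm_minus_commute)
      then have "\<bar>f y\<bar> * \<bar>gauss_2eps eps (x' - y) - gauss_2eps eps (x - y)\<bar> \<le> C * (A * gauss_2eps (2 * eps) (x - y) * norm (x' - x))"
        using C[of y] C0 by (intro mult_mono) auto
      then show ?thesis by (simp add: mult_ac flip: abs_mult right_diff_distrib)
    qed
  qed (use D B in auto)
  then show "GDERIV (conv_gauss eps f) x :> grad_conv_gauss eps f x"
    by (simp add: conv_gauss_def[abs_def] grad_conv_gauss_def)
qed

text \<open>The reverse local log-Sobolev inequality of the Gaussian kernel: Gibbs' variational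
  inequality, tested against the exponentially tilted kernel, which is a translate of the kernel.\<close>

lemma reverse_local_LSI_gauss:
  fixes f :: "'a::euclidean_space \<Rightarrow> real"
  assumes eps: "0 < eps" and f[measurable]: "f \<in> borel_measurable borel"
    and c: "0 < c" "\<And>y. c \<le> f y" and C: "\<And>y. f y \<le> C"
  shows "eps * (norm (grad_conv_gauss eps f x))\<^sup>2
    \<le> conv_gauss eps f x * (conv_gauss eps (\<lambda>y. f y * ln (f y)) x - conv_gauss eps f x * ln (conv_gauss eps f x))"
proof -
  define G where "G = conv_gauss eps f x"
  define E where "E = conv_gauss eps (\<lambda>y. f y * ln (f y)) x"
  define D where "D = grad_conv_gauss eps f x"
  have fpos: "0 < f y" for y using c(1) c(2)[of y] by linarith
  have f_abs: "\<bar>f y\<bar> \<le> C" for y using fpos[of y] C[of y] by simp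
  have ln_abs: "\<bar>f y * ln (f y)\<bar> \<le> C * (\<bar>ln c\<bar> + \<bar>ln C\<bar>)" for y
  proof -
    have "ln c \<le> ln (f y)" "ln (f y) \<le> ln C"
      using c(1) c(2)[of y] C[of y] by (auto intro!: ln_mono)
    then have "\<bar>ln (f y)\<bar> \<le> \<bar>ln c\<bar> + \<bar>ln C\<bar>" by linarith
    then show ?thesis unfolding abs_mult using f_abs[of y] by (intro mult_mono) auto
  qed
  have "c \<le> G"
    unfolding G_def using conv_gauss_mono[OF eps _ f, of "\<lambda>_. c" "\<bar>c\<bar>" C x] c f_abs conv_gauss_const[OF eps, of c x]
    by simp
  then have G: "0 < G" using c by linarith
  have int1: "integrable lborel (\<lambda>y. f y * gauss_2eps eps (x - y))"
    by (rule integrable_conv_gauss[OF eps f f_abs])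
  have int2: "integrable lborel (\<lambda>y. (f y * ln (f y)) * gauss_2eps eps (x - y))"
    by (rule integrable_conv_gauss[OF eps _ ln_abs]) measurable
  have int3: "integrable lborel (\<lambda>y. (f y * gauss_2eps eps (x - y) / (2 * eps)) *\<^sub>R (y - x))"
    by (rule integrable_grad_conv_gauss[OF eps f f_abs])
  \<comment> \<open>A bound that is quadratic in a free vector \<open>v\<close>; optimising over
    \<open>v\<close> at the end turns it into a bound on the norm of \<open>D\<close>.\<close>
  have *: "v \<bullet> D \<le> E - G * ln G + G * (norm v)\<^sup>2 / (4 * eps)" for v
  proof -
    let ?s = "\<lambda>y. (v \<bullet> (y - x)) / (2 * eps)"
    define m where "m = (norm v)\<^sup>2 / (4 * eps)"
    \<comment> \<open>With this factor the tilted kernel has the same total mass \<open>G\<close> as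
      \<open>f\<close> times the kernel, so the constants produced by 1 + t \<le> exp t cancel after
      integration.\<close>
    let ?c = "G * exp (- m)"
    have tilt: "exp (- m) * exp (?s y) * gauss_2eps eps (x - y) = gauss_2eps eps (x + v - y)" for y
    proof -
      have "- m + ?s y + - (norm (x - y))\<^sup>2 / (4 * eps) = - (norm (x + v - y))\<^sup>2 / (4 * eps)"
        using eps unfolding m_def power2_norm_eq_inner
        by (simp add: inner_diff inner_add inner_commute field_simps)
      then show ?thesis by (simp add: gauss_2eps_def mult_ac flip: exp_add)
    qed
    have ptw: "?s y * f y * gauss_2eps eps (x - y)
        \<le> f y * ln (f y) * gauss_2eps eps (x - y) - (ln G - m + 1) * (f y * gauss_2eps eps (x - y)) + G * gauss_2eps eps (x + v - y)" for y
    proof -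
      have lnc: "ln ?c = ln G - m" using G by (simp add: ln_mult)
      let ?u = "?s y - ln (f y) + ln ?c"
      have "f y * (1 + ?u) \<le> f y * exp ?u"
        using exp_ge_add_one_self fpos[of y] by (intro mult_left_mono) auto
      also have "\<dots> = ?c * exp (?s y)"
        using fpos[of y] G by (simp add: exp_add exp_diff)
      finally have "f y * (1 + ?u) * gauss_2eps eps (x - y) \<le> ?c * exp (?s y) * gauss_2eps eps (x - y)"
        using gauss_2eps_pos[OF eps, of "x - y"] by (intro mult_right_mono) auto
      also have "\<dots> = G * gauss_2eps eps (x + v - y)"
        using tilt[of y] by (simp add: mult.assoc)
      finally show ?thesis unfolding lnc by (simp add: algebra_simps)
    qed
    have eq: "v \<bullet> (f y * gauss_2eps eps (x - y) / (2 * eps)) *\<^sub>R (y - x) = ?s y * f y * gauss_2eps eps (x - y)" for y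
      by simp
    have "v \<bullet> D = (\<integral>y. v \<bullet> (f y * gauss_2eps eps (x - y) / (2 * eps)) *\<^sub>R (y - x) \<partial>lborel)"
      unfolding D_def grad_conv_gauss_def by (rule integral_inner_right[symmetric]) (use int3 in auto)
    also have "\<dots> = (\<integral>y. ?s y * f y * gauss_2eps eps (x - y) \<partial>lborel)"
      by (simp only: eq)
    also have "\<dots> \<le> (\<integral>y. f y * ln (f y) * gauss_2eps eps (x - y) - (ln G - m + 1) * (f y * gauss_2eps eps (x - y)) + G * gauss_2eps eps (x + v - y) \<partial>lborel)"
    proof (rule integral_mono[OF _ _ ptw])
      show "integrable lborel (\<lambda>y. ?s y * f y * gauss_2eps eps (x - y))"
        using integrable_inner_right[OF int3, of v] by (simp only: eq)
    qed (use int1 int2 integrable_gauss_2eps_shift[OF eps, of "x + v"] in auto)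
    also have "\<dots> = E - (ln G - m + 1) * G + G"
      using int1 int2 integrable_gauss_2eps_shift[OF eps, of "x + v"] integral_gauss_2eps_shift[OF eps, of "x + v"]
      by (simp add: E_def G_def conv_gauss_def)
    also have "\<dots> = E - G * ln G + G * m" by (simp add: algebra_simps)
    finally show ?thesis by (simp add: m_def)
  qed
  \<comment> \<open>The vector \<open>(2 * eps / G) *\<^sub>R D\<close> maximises the difference of
    the linear term and the quadratic penalty
    \<open>G * (norm v)\<^sup>2 / (4 * eps)\<close>.\<close>
  have "(2 * eps / G) * (norm D)\<^sup>2 \<le> E - G * ln G + (eps / G) * (norm D)\<^sup>2"
    using *[of "(2 * eps / G) *\<^sub>R D"] G eps
    by (simp add: power2_norm_eq_inner[symmetric] power_mult_distrib power2_eq_square field_simps)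
  then have "eps * (norm D)\<^sup>2 \<le> G * (E - G * ln G)"
    using G by (simp add: field_simps)
  then show ?thesis by (simp add: G_def E_def D_def)
qed

section \<open>Hypercontractivity of the Gaussian kernel\<close>

text \<open>The kernel acts on powers of \<open>k = exp u\<close>; bounding \<open>u\<close> keeps \<open>k\<close> away from 0 and infinity.\<close>

definition log_pmean :: "real \<Rightarrow> ('a::euclidean_space \<Rightarrow> real) \<Rightarrow> real \<Rightarrow> 'a \<Rightarrow> real" where
  "log_pmean eps u \<alpha> x = ln (conv_gauss eps (\<lambda>y. exp (\<alpha> * u y)) x) / \<alpha>"

text \<open>Multiplied by \<open>\<alpha>\<^sup>2 * G\<close>, this is the entropy of
  \<open>exp (\<alpha> * u y)\<close> under the kernel centred at \<open>x\<close>, the quantity in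
  the reverse local log-Sobolev inequality.\<close>

definition log_pmean_deriv :: "real \<Rightarrow> ('a::euclidean_space \<Rightarrow> real) \<Rightarrow> real \<Rightarrow> 'a \<Rightarrow> real" where
  "log_pmean_deriv eps u \<alpha> x =
     (let G = conv_gauss eps (\<lambda>y. exp (\<alpha> * u y)) x
      in conv_gauss eps (\<lambda>y. u y * exp (\<alpha> * u y)) x / (\<alpha> * G) - ln G / \<alpha>\<^sup>2)"

lemma borel_measurable_log_pmean [measurable]:
  assumes [measurable]: "u \<in> borel_measurable borel"
  shows "log_pmean eps u \<alpha> \<in> borel_measurable borel" "log_pmean_deriv eps u \<alpha> \<in> borel_measurable borel"
  unfolding log_pmean_def[abs_def] log_pmean_deriv_def[abs_def] Let_def by measurable

context
  fixes eps K :: real and u :: "'a::euclidean_space \<Rightarrow> real"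
  assumes eps: "0 < eps" and u[measurable]: "u \<in> borel_measurable borel" and K: "\<And>y. \<bar>u y\<bar> \<le> K"
begin

lemma bounded_exp_times: "\<bar>exp (\<alpha> * u y)\<bar> \<le> exp (\<bar>\<alpha>\<bar> * K)" "\<bar>u y * exp (\<alpha> * u y)\<bar> \<le> K * exp (\<bar>\<alpha>\<bar> * K)"
proof -
  have "\<alpha> * u y \<le> \<bar>\<alpha>\<bar> * \<bar>u y\<bar>" by (simp flip: abs_mult)
  also have "\<dots> \<le> \<bar>\<alpha>\<bar> * K" using K[of y] by (intro mult_left_mono) auto
  finally show 1: "\<bar>exp (\<alpha> * u y)\<bar> \<le> exp (\<bar>\<alpha>\<bar> * K)" by simp
  then show "\<bar>u y * exp (\<alpha> * u y)\<bar> \<le> K * exp (\<bar>\<alpha>\<bar> * K)"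
    unfolding abs_mult using K[of y] by (intro mult_mono) auto
qed

lemma conv_gauss_exp_bounds:
  assumes "0 \<le> \<alpha>"
  shows "exp (- (\<alpha> * K)) \<le> conv_gauss eps (\<lambda>y. exp (\<alpha> * u y)) x" "conv_gauss eps (\<lambda>y. exp (\<alpha> * u y)) x \<le> exp (\<alpha> * K)"
proof -
  have *: "- (\<alpha> * K) \<le> \<alpha> * u y" "\<alpha> * u y \<le> \<alpha> * K" for y
    using mult_left_mono[OF _ assms, of "- K" "u y"] mult_left_mono[OF _ assms, of "u y" K] K[of y]
    by (auto simp: abs_le_iff)
  have "conv_gauss eps (\<lambda>y::'a. exp (- (\<alpha> * K))) x \<le> conv_gauss eps (\<lambda>y. exp (\<alpha> * u y)) x"
    by (rule conv_gauss_mono[OF eps _ _ _ bounded_exp_times(1)]) (use * in auto)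
  then show "exp (- (\<alpha> * K)) \<le> conv_gauss eps (\<lambda>y. exp (\<alpha> * u y)) x"
    by (simp add: conv_gauss_const[OF eps])
  have "conv_gauss eps (\<lambda>y. exp (\<alpha> * u y)) x \<le> conv_gauss eps (\<lambda>y::'a. exp (\<alpha> * K)) x"
    by (rule conv_gauss_mono[OF eps _ _ bounded_exp_times(1)]) (use * in auto)
  then show "conv_gauss eps (\<lambda>y. exp (\<alpha> * u y)) x \<le> exp (\<alpha> * K)"
    by (simp add: conv_gauss_const[OF eps])
qed

lemma conv_gauss_exp_pos: "0 \<le> \<alpha> \<Longrightarrow> 0 < conv_gauss eps (\<lambda>y. exp (\<alpha> * u y)) x"
  using conv_gauss_exp_bounds(1)[of \<alpha> x] by (meson exp_gt_zero less_le_trans)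

text \<open>The quotient of the two convolutions is a weighted mean of \<open>u\<close>, hence lies
  between \<open>- K\<close> and \<open>K\<close>, uniformly in \<alpha>.\<close>

lemma abs_conv_gauss_times_exp_le:
  "\<bar>conv_gauss eps (\<lambda>y. u y * exp (\<alpha> * u y)) x\<bar> \<le> K * conv_gauss eps (\<lambda>y. exp (\<alpha> * u y)) x"
proof -
  have B: "\<bar>c * exp (\<alpha> * u y)\<bar> \<le> \<bar>c\<bar> * exp (\<bar>\<alpha>\<bar> * K)" for c y
    unfolding abs_mult using bounded_exp_times(1)[of \<alpha> y] by (intro mult_left_mono) auto
  have lo: "(- K) * exp (\<alpha> * u y) \<le> u y * exp (\<alpha> * u y)" and hi: "u y * exp (\<alpha> * u y) \<le> K * exp (\<alpha> * u y)" for y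
    by (rule mult_right_mono, use K[of y] in \<open>simp_all add: abs_le_iff minus_le_iff\<close>)+
  have "conv_gauss eps (\<lambda>y. u y * exp (\<alpha> * u y)) x \<le> conv_gauss eps (\<lambda>y. K * exp (\<alpha> * u y)) x"
    by (rule conv_gauss_mono[OF eps _ _ bounded_exp_times(2) B hi]) measurable
  moreover have "conv_gauss eps (\<lambda>y. (- K) * exp (\<alpha> * u y)) x \<le> conv_gauss eps (\<lambda>y. u y * exp (\<alpha> * u y)) x"
    by (rule conv_gauss_mono[OF eps _ _ B bounded_exp_times(2) lo]) measurable
  ultimately show ?thesis unfolding conv_gauss_cmult by (simp add: abs_le_iff)
qed

lemma DERIV_conv_gauss_exp:
  "((\<lambda>\<alpha>. conv_gauss eps (\<lambda>y. exp (\<alpha> * u y)) x) has_real_derivative conv_gauss eps (\<lambda>y. u y * exp (\<alpha> * u y)) x) (at \<alpha>)"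
  unfolding conv_gauss_def
proof (rule has_real_derivative_integral[where r=1 and B="\<lambda>y. K * exp ((\<bar>\<alpha>\<bar> + 1) * K) * gauss_2eps eps (x - y)"
      and F'="\<lambda>\<alpha> y. u y * exp (\<alpha> * u y) * gauss_2eps eps (x - y)"])
  show "integrable lborel (\<lambda>y. exp (t * u y) * gauss_2eps eps (x - y))" for t
    by (rule integrable_conv_gauss[OF eps _ bounded_exp_times(1)]) measurable
  show "((\<lambda>t. exp (t * u y) * gauss_2eps eps (x - y)) has_real_derivative u y * exp (t * u y) * gauss_2eps eps (x - y)) (at t)" for t y
    by (auto intro!: derivative_eq_intros)
  show "\<bar>u y * exp (t * u y) * gauss_2eps eps (x - y)\<bar> \<le> K * exp ((\<bar>\<alpha>\<bar> + 1) * K) * gauss_2eps eps (x - y)"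
    if "t \<in> ball \<alpha> 1" for t y
  proof -
    have "0 \<le> K" using K[of y] by linarith
    have "\<bar>t\<bar> \<le> \<bar>\<alpha>\<bar> + 1" using that by (auto simp: dist_real_def)
    then have "K * exp (\<bar>t\<bar> * K) \<le> K * exp ((\<bar>\<alpha>\<bar> + 1) * K)"
      using \<open>0 \<le> K\<close> by (intro mult_left_mono) (auto intro: mult_right_mono)
    then have "\<bar>u y * exp (t * u y)\<bar> \<le> K * exp ((\<bar>\<alpha>\<bar> + 1) * K)"
      using bounded_exp_times(2)[of y t] by linarith
    then have "\<bar>u y * exp (t * u y)\<bar> * gauss_2eps eps (x - y) \<le> K * exp ((\<bar>\<alpha>\<bar> + 1) * K) * gauss_2eps eps (x - y)"
      using gauss_2eps_pos[OF eps, of "x - y"] by (intro mult_right_mono) auto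
    then show ?thesis
      using gauss_2eps_pos[OF eps, of "x - y"] by (simp add: abs_mult)
  qed
qed (use integrable_gauss_2eps_shift[OF eps, of x] in auto)

lemma abs_log_pmean_le:
  assumes "0 < \<alpha>" shows "\<bar>log_pmean eps u \<alpha> x\<bar> \<le> K"
proof -
  have "- (\<alpha> * K) \<le> ln (conv_gauss eps (\<lambda>y. exp (\<alpha> * u y)) x)" "ln (conv_gauss eps (\<lambda>y. exp (\<alpha> * u y)) x) \<le> \<alpha> * K"
    using conv_gauss_exp_bounds[of \<alpha> x] conv_gauss_exp_pos[of \<alpha> x] assms
      ln_mono[of "conv_gauss eps (\<lambda>y. exp (\<alpha> * u y)) x" "exp (\<alpha> * K)"]
    by (auto simp: ln_ge_iff)
  then show ?thesis using assms by (auto simp: log_pmean_def abs_le_iff field_simps)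
qed

lemma abs_log_pmean_deriv_le:
  assumes "0 < \<alpha>" shows "\<bar>log_pmean_deriv eps u \<alpha> x\<bar> \<le> 2 * K / \<alpha>"
proof -
  let ?G = "conv_gauss eps (\<lambda>y. exp (\<alpha> * u y)) x"
  have G: "0 < ?G" using conv_gauss_exp_pos assms by auto
  have 1: "\<bar>conv_gauss eps (\<lambda>y. u y * exp (\<alpha> * u y)) x / (\<alpha> * ?G)\<bar> \<le> K / \<alpha>"
    using abs_conv_gauss_times_exp_le[of \<alpha> x] G assms by (simp add: abs_mult field_simps)
  have "ln ?G / \<alpha>\<^sup>2 = log_pmean eps u \<alpha> x / \<alpha>" by (simp add: log_pmean_def power2_eq_square)
  then have 2: "\<bar>ln ?G / \<alpha>\<^sup>2\<bar> \<le> K / \<alpha>"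
    using abs_log_pmean_le[OF assms, of x] assms by (simp add: divide_right_mono)
  show ?thesis unfolding log_pmean_deriv_def Let_def using 1 2 by linarith
qed

lemma DERIV_log_pmean:
  assumes "0 < \<alpha>"
  shows "((\<lambda>\<alpha>. log_pmean eps u \<alpha> x) has_real_derivative log_pmean_deriv eps u \<alpha> x) (at \<alpha>)"
  unfolding log_pmean_def log_pmean_deriv_def Let_def
  using assms conv_gauss_exp_pos[of \<alpha> x]
  by (auto intro!: derivative_eq_intros DERIV_conv_gauss_exp simp: field_simps power2_eq_square)

lemma GDERIV_log_pmean:
  assumes "0 < \<alpha>"
  shows "GDERIV (log_pmean eps u \<alpha>) x :>
    (1 / (\<alpha> * conv_gauss eps (\<lambda>y. exp (\<alpha> * u y)) x)) *\<^sub>R grad_conv_gauss eps (\<lambda>y. exp (\<alpha> * u y)) x"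
proof -
  have "DERIV (\<lambda>t. ln t / \<alpha>) (conv_gauss eps (\<lambda>y. exp (\<alpha> * u y)) x) :> 1 / (\<alpha> * conv_gauss eps (\<lambda>y. exp (\<alpha> * u y)) x)"
    using assms conv_gauss_exp_pos[of \<alpha> x] by (auto intro!: derivative_eq_intros simp: field_simps)
  from GDERIV_DERIV_compose[OF GDERIV_conv_gauss[OF eps _ bounded_exp_times(1)] this]
  show ?thesis by (simp add: log_pmean_def[abs_def])
qed

text \<open>In the time variable \<open>2 * eps * (a - \<alpha>)\<close> this makes the power means a subsolution of the
  Hamilton--Jacobi equation \<open>\<partial>\<^sub>t V + |\<nabla>V|\<^sup>2 / 2 = 0\<close>.\<close>

lemma norm_grad_log_pmean_le:
  assumes "0 < \<alpha>"
  shows "eps * (norm ((1 / (\<alpha> * conv_gauss eps (\<lambda>y. exp (\<alpha> * u y)) x)) *\<^sub>R grad_conv_gauss eps (\<lambda>y. exp (\<alpha> * u y)) x))\<^sup>2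
    \<le> log_pmean_deriv eps u \<alpha> x"
proof -
  define G where "G = conv_gauss eps (\<lambda>y. exp (\<alpha> * u y)) x"
  define E where "E = conv_gauss eps (\<lambda>y. u y * exp (\<alpha> * u y)) x"
  define D where "D = grad_conv_gauss eps (\<lambda>y. exp (\<alpha> * u y)) x"
  have G: "0 < G" using conv_gauss_exp_pos assms by (auto simp: G_def)
  have "exp (- (\<bar>\<alpha>\<bar> * K)) \<le> exp (\<alpha> * u y)" for y
    using bounded_exp_times(1)[of "- \<alpha>" y] by (simp add: minus_le_iff)
  \<comment> \<open>The reverse local inequality is applied to \<open>exp (\<alpha> * u y)\<close>.
    Its logarithm is linear in \<open>u\<close>, so the entropy term is \<alpha> times the
    derivative of the convolution in \<alpha>.\<close>
  then have "eps * (norm D)\<^sup>2 \<le> G * (conv_gauss eps (\<lambda>y. exp (\<alpha> * u y) * ln (exp (\<alpha> * u y))) x - G * ln G)"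
    unfolding D_def G_def
    by (intro reverse_local_LSI_gauss[OF eps, where c="exp (- (\<bar>\<alpha>\<bar> * K))" and C="exp (\<bar>\<alpha>\<bar> * K)"])
       (use bounded_exp_times(1) in auto)
  also have "conv_gauss eps (\<lambda>y. exp (\<alpha> * u y) * ln (exp (\<alpha> * u y))) x = \<alpha> * E"
    unfolding E_def conv_gauss_cmult[symmetric] by (simp add: mult_ac)
  finally have "eps * (norm D)\<^sup>2 / (\<alpha> * G)\<^sup>2 \<le> G * (\<alpha> * E - G * ln G) / (\<alpha> * G)\<^sup>2"
    by (rule divide_right_mono) simp
  also have "\<dots> = E / (\<alpha> * G) - ln G / \<alpha>\<^sup>2"
    using G assms by (simp add: power2_eq_square field_simps)
  finally show ?thesis
    using G assms by (simp add: log_pmean_deriv_def G_def[symmetric] E_def[symmetric] D_def[symmetric] power_divide)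
qed

end

section \<open>Integration against a probability density and the log-Sobolev inequality for
  exponential tilts\<close>

lemma prob_density_integrable:
  assumes "prob_density \<nu>"
  shows "integrable lborel \<nu>" and "(\<integral>x. \<nu> x \<partial>lborel) = 1"
  using assms unfolding prob_density_def
  by (auto intro!: integrableI_nonneg simp: integral_eq_nn_integral)

lemma prob_density_measurable: "prob_density \<nu> \<Longrightarrow> \<nu> \<in> borel_measurable borel"
  by (simp add: prob_density_def)

lemma integrable_bounded_times_density:
  fixes f :: "'a::euclidean_space \<Rightarrow> real"
  assumes "prob_density \<nu>" and [measurable]: "f \<in> borel_measurable borel" and "\<And>x. \<bar>f x\<bar> \<le> C"
  shows "integrable lborel (\<lambda>x. f x * \<nu> x)"
proof (rule Bochner_Integration.integrable_bound)
  have [measurable]: "\<nu> \<in> borel_measurable borel" by (rule prob_density_measurable[OF assms(1)])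
  show "(\<lambda>x. f x * \<nu> x) \<in> borel_measurable lborel" by measurable
  show "integrable lborel (\<lambda>x. C * \<nu> x)" using prob_density_integrable[OF assms(1)] by simp
  show "AE x in lborel. norm (f x * \<nu> x) \<le> norm (C * \<nu> x)"
    unfolding norm_mult using assms(3) by (intro AE_I2 mult_right_mono) (auto intro: order_trans[OF _ abs_ge_self])
qed

lemma integral_pos_times_density:
  fixes f :: "'a::euclidean_space \<Rightarrow> real"
  assumes "prob_density \<nu>" and "integrable lborel (\<lambda>x. f x * \<nu> x)" and "0 < c" and "\<And>x. c \<le> f x"
  shows "0 < (\<integral>x. f x * \<nu> x \<partial>lborel)"
proof -
  have "c = (\<integral>x. c * \<nu> x \<partial>lborel)" using prob_density_integrable[OF assms(1)] by simp
  also have "\<dots> \<le> (\<integral>x. f x * \<nu> x \<partial>lborel)"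
    using assms prob_density_integrable[OF assms(1)]
    by (intro integral_mono) (auto intro!: mult_right_mono simp: prob_density_def)
  finally show ?thesis using assms(3) by linarith
qed

text \<open>The test density is exp W times \<nu>, normalised; its log-ratio to \<nu> is W minus a
  constant, so both have the same gradient. The bounded majorant \<open>S\<close> of the squared
  gradient makes the Fisher information a finite real integral; in the application it is a multiple
  of the \<alpha>-derivative of the power mean.\<close>

lemma LSI_exp:
  fixes \<nu> W :: "'a::euclidean_space \<Rightarrow> real"
  assumes \<nu>: "prob_density \<nu>" "\<And>x. 0 < \<nu> x" and LSI: "LSI \<nu> \<beta>" and \<beta>: "0 < \<beta>"
    and W[measurable]: "W \<in> borel_measurable borel" and W_le: "\<And>x. \<bar>W x\<bar> \<le> C"
    and grad: "\<And>x. GDERIV W x :> g x"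
    and S: "S \<in> borel_measurable borel" "\<And>x. (norm (g x))\<^sup>2 \<le> S x" "\<And>x. \<bar>S x\<bar> \<le> C'"
  defines "N \<equiv> \<integral>x. exp (W x) * \<nu> x \<partial>lborel"
  shows "(\<integral>x. exp (W x) * W x * \<nu> x \<partial>lborel) - N * ln N \<le> 1 / (2 * \<beta>) * (\<integral>x. exp (W x) * S x * \<nu> x \<partial>lborel)"
proof -
  note [measurable] = S(1) prob_density_measurable[OF \<nu>(1)]
  have eW: "exp (- C) \<le> exp (W x)" "\<bar>exp (W x)\<bar> \<le> exp C" for x
    using W_le[of x] by (auto simp: abs_le_iff minus_le_iff)
  have int1: "integrable lborel (\<lambda>x. exp (W x) * \<nu> x)"
    by (rule integrable_bounded_times_density[OF \<nu>(1) _ eW(2)]) measurable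
  have "\<bar>exp (W x) * W x\<bar> \<le> exp C * C" for x
    unfolding abs_mult using eW(2)[of x] W_le[of x] by (intro mult_mono) auto
  then have int2: "integrable lborel (\<lambda>x. exp (W x) * W x * \<nu> x)"
    by (intro integrable_bounded_times_density[OF \<nu>(1)]) measurable
  have "\<bar>exp (W x) * S x\<bar> \<le> exp C * C'" for x
    unfolding abs_mult using eW(2)[of x] S(3)[of x] by (intro mult_mono) auto
  then have int3: "integrable lborel (\<lambda>x. exp (W x) * S x * \<nu> x)"
    by (intro integrable_bounded_times_density[OF \<nu>(1)]) measurable
  have N: "0 < N" unfolding N_def by (rule integral_pos_times_density[OF \<nu>(1) int1 _ eW(1)]) simp
  have S0: "0 \<le> S x" for x using S(2)[of x] by (meson order_trans zero_le_power2)
  define \<rho> where "\<rho> x = exp (W x) * \<nu> x / N" for x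
  have \<rho>_meas[measurable]: "\<rho> \<in> borel_measurable borel" unfolding \<rho>_def by measurable
  have \<rho>_pos: "0 < \<rho> x" for x unfolding \<rho>_def using N \<nu>(2)[of x] by simp
  have ratio: "ln (\<rho> x / \<nu> x) = W x - ln N" for x
    using \<nu>(2)[of x] N by (simp add: \<rho>_def ln_div)
  have "prob_density \<rho>"
  proof -
    have "(\<integral>\<^sup>+ x. ennreal (\<rho> x) \<partial>lborel) = ennreal (\<integral>x. \<rho> x \<partial>lborel)"
      by (rule nn_integral_eq_integral) (use int1 \<rho>_pos in \<open>auto simp: \<rho>_def less_imp_le\<close>)
    also have "(\<integral>x. \<rho> x \<partial>lborel) = 1" unfolding \<rho>_def using N by (simp flip: N_def)
    finally show ?thesis using \<rho>_pos by (auto simp: prob_density_def less_imp_le)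
  qed
  moreover have "GDERIV (\<lambda>y. ln (\<rho> y / \<nu> y)) x :> g x" for x
    unfolding ratio using GDERIV_diff[OF grad[of x] GDERIV_const, of "ln N"] by simp
  moreover have eq: "\<rho> x * ln (\<rho> x / \<nu> x) = (exp (W x) * W x * \<nu> x - ln N * (exp (W x) * \<nu> x)) / N" for x
    unfolding ratio unfolding \<rho>_def using N by (simp add: field_simps)
  moreover have "integrable lborel (\<lambda>x. \<rho> x * ln (\<rho> x / \<nu> x))"
    unfolding eq using int1 int2 by simp
  ultimately have "ennreal (KL \<nu> \<rho>) \<le> ennreal (1 / (2 * \<beta>)) * (\<integral>\<^sup>+ x. ennreal (\<rho> x * (norm (g x))\<^sup>2) \<partial>lborel)"
    using LSI \<rho>_pos unfolding LSI_def by blast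
  also have "(\<integral>\<^sup>+ x. ennreal (\<rho> x * (norm (g x))\<^sup>2) \<partial>lborel) \<le> (\<integral>\<^sup>+ x. ennreal (exp (W x) * S x * \<nu> x / N) \<partial>lborel)"
  proof (intro nn_integral_mono ennreal_leI)
    fix x
    have "\<rho> x * (norm (g x))\<^sup>2 \<le> \<rho> x * S x" using \<rho>_pos[of x] S(2)[of x] by (intro mult_left_mono) auto
    then show "\<rho> x * (norm (g x))\<^sup>2 \<le> exp (W x) * S x * \<nu> x / N" by (simp add: \<rho>_def mult_ac)
  qed
  also have "\<dots> = ennreal (\<integral>x. exp (W x) * S x * \<nu> x / N \<partial>lborel)"
    by (rule nn_integral_eq_integral) (use int3 S0 N \<nu>(2) in \<open>auto simp: less_imp_le\<close>)
  finally have KL_le: "ennreal (KL \<nu> \<rho>) \<le> ennreal (1 / (2 * \<beta>)) * ennreal (\<integral>x. exp (W x) * S x * \<nu> x / N \<partial>lborel)"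
    by (simp add: mult_left_mono)
  have nn: "0 \<le> (\<integral>x. exp (W x) * S x * \<nu> x / N \<partial>lborel)"
    using S0 N \<nu>(2) by (intro integral_nonneg_AE AE_I2) (auto simp: less_imp_le)
  \<comment> \<open>\<open>ennreal\<close> sends negative reals to 0, so the inequality is read back
    in the reals through nonnegativity of the right side.\<close>
  have "KL \<nu> \<rho> \<le> 1 / (2 * \<beta>) * (\<integral>x. exp (W x) * S x * \<nu> x / N \<partial>lborel)"
  proof (rule ennreal_le_iff[THEN iffD1])
    show "0 \<le> 1 / (2 * \<beta>) * (\<integral>x. exp (W x) * S x * \<nu> x / N \<partial>lborel)"
      using \<beta> nn by (intro mult_nonneg_nonneg) auto
    show "ennreal (KL \<nu> \<rho>) \<le> ennreal (1 / (2 * \<beta>) * (\<integral>x. exp (W x) * S x * \<nu> x / N \<partial>lborel))"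
      using KL_le \<beta> nn by (subst ennreal_mult) auto
  qed
  moreover have "KL \<nu> \<rho> = ((\<integral>x. exp (W x) * W x * \<nu> x \<partial>lborel) - ln N * N) / N"
    unfolding KL_def eq using int1 int2 by (simp add: N_def)
  ultimately have "((\<integral>x. exp (W x) * W x * \<nu> x \<partial>lborel) - ln N * N) / N \<le> (1 / (2 * \<beta>) * (\<integral>x. exp (W x) * S x * \<nu> x \<partial>lborel)) / N"
    by simp
  then show ?thesis using N by (simp only: divide_le_cancel mult.commute[of "ln N"])
qed

text \<open>The \<open>L\<^sup>b\<^sup>(\<^sup>\<alpha>\<^sup>)\<close> norm of the exponential of the power mean is nondecreasing in \<open>\<alpha>\<close> along
  \<open>b(\<alpha>) = a + 2\<beta>\<epsilon>(a - \<alpha>)\<close>.\<close>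

lemma hypercontractivity_gauss:
  fixes \<nu> u :: "'a::euclidean_space \<Rightarrow> real"
  assumes eps: "0 < eps" and \<nu>: "prob_density \<nu>" "\<And>x. 0 < \<nu> x" and LSI: "LSI \<nu> \<beta>" and \<beta>: "0 < \<beta>"
    and u[measurable]: "u \<in> borel_measurable borel" and K: "\<And>y. \<bar>u y\<bar> \<le> K"
    and a: "1 < a"
  defines "b \<equiv> a + 2 * \<beta> * eps * (a - 1)"
  shows "(\<integral>x. conv_gauss eps (\<lambda>y. exp (u y)) x powr b * \<nu> x \<partial>lborel) powr (1 / b)
    \<le> (\<integral>x. conv_gauss eps (\<lambda>y. exp (a * u y)) x * \<nu> x \<partial>lborel) powr (1 / a)"
proof -
  note [measurable] = prob_density_measurable[OF \<nu>(1)] borel_measurable_log_pmean[OF u]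
  let ?V = "log_pmean eps u" and ?V' = "log_pmean_deriv eps u"
  define c where "c = 2 * \<beta> * eps"
  have c: "0 < c" using \<beta> eps by (simp add: c_def)
  \<comment> \<open>The path runs from \<open>e 1 = b\<close> to \<open>e a = a\<close>. The slope
    \<open>- c\<close> is chosen so that the constants of the log-Sobolev inequality and of the
    gradient bound cancel: \<open>c / (2 * \<beta> * eps) = 1\<close>.\<close>
  define e where "e t = a + c * (a - t)" for t
  define N where "N t = (\<integral>x. exp (e t * ?V t x) * \<nu> x \<partial>lborel)" for t
  define B where "B = a + c * (a + 1)"
  have K0: "0 \<le> K" using K[of 0] by linarith
  have B0: "0 \<le> B" using a c by (simp add: B_def)
  \<comment> \<open>The estimates cover an open neighbourhood of the interval from 1 to
    \<open>a\<close>, because derivatives at its end points are two-sided.\<close>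
  have e_le: "\<bar>e t\<bar> \<le> B" if "0 < t" "t < a + 1" for t
  proof -
    have "\<bar>a - t\<bar> \<le> a + 1" using that a by linarith
    then have "\<bar>c * (a - t)\<bar> \<le> c * (a + 1)" using c by (simp add: abs_mult)
    then show ?thesis using a unfolding e_def B_def by linarith
  qed
  have eV: "\<bar>e t * ?V t x\<bar> \<le> B * K" if "0 < t" "t < a + 1" for t x
    unfolding abs_mult using e_le[OF that] abs_log_pmean_le[OF eps u K that(1)] B0 by (intro mult_mono) auto
  have exp_eV: "\<bar>exp (e t * ?V t x)\<bar> \<le> exp (B * K)" "exp (- (B * K)) \<le> exp (e t * ?V t x)"
    if "0 < t" "t < a + 1" for t x
    using eV[OF that, of x] by (auto simp: abs_le_iff minus_le_iff)
  have intN: "integrable lborel (\<lambda>x. exp (e t * ?V t x) * \<nu> x)" if "0 < t" "t < a + 1" for t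
    by (rule integrable_bounded_times_density[OF \<nu>(1) _ exp_eV(1)[OF that]]) measurable
  have Npos: "0 < N t" if "0 < t" "t < a + 1" for t
    unfolding N_def by (rule integral_pos_times_density[OF \<nu>(1) intN[OF that] _ exp_eV(2)[OF that]]) simp
  have mono: "\<exists>D. ((\<lambda>t. ln (N t) / e t) has_real_derivative D) (at t) \<and> 0 \<le> D" if t: "1 \<le> t" "t \<le> a" for t
  proof -
    have t': "0 < t" "t < a + 1" using t by auto
    have e: "0 < e t" unfolding e_def using a c t by (intro add_pos_nonneg mult_nonneg_nonneg) auto
    \<comment> \<open>A ball of radius 1/2 about \<open>t\<close> stays above 1/2, so the bound
      \<open>2 * K / s\<close> on the \<alpha>-derivative is at most \<open>4 * K\<close>;
      \<open>c * K\<close> accounts for the moving exponent.\<close>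
    define M where "M = exp (B * K) * (c * K + B * (4 * K))"
    define F' where "F' s x = exp (e s * ?V s x) * (- c * ?V s x + e s * ?V' s x) * \<nu> x" for s x
    have dN: "(N has_real_derivative (\<integral>x. F' t x \<partial>lborel)) (at t)"
      unfolding N_def
    proof (rule has_real_derivative_integral[where r="1/2" and B="\<lambda>x. M * \<nu> x" and F'=F'])
      fix s x assume "s \<in> ball t (1/2)"
      then have s: "1/2 < s" "0 < s" "s < a + 1" using t by (auto simp: dist_real_def abs_if split: if_splits)
      show "integrable lborel (\<lambda>x. exp (e s * ?V s x) * \<nu> x)" by (rule intN[OF s(2,3)])
      show "((\<lambda>s. exp (e s * ?V s x) * \<nu> x) has_real_derivative F' s x) (at s)"
        unfolding F'_def
        by (auto simp: e_def intro!: derivative_eq_intros DERIV_log_pmean[OF eps u K s(2)])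
      have "\<bar>?V' s x\<bar> \<le> 2 * K / s" by (rule abs_log_pmean_deriv_le[OF eps u K s(2)])
      also have "\<dots> \<le> 4 * K"
        using s mult_left_mono[of "1/2" s K] K0 by (simp add: field_simps)
      finally have "\<bar>e s * ?V' s x\<bar> \<le> B * (4 * K)"
        unfolding abs_mult using e_le[OF s(2,3)] B0 by (intro mult_mono) auto
      moreover have "\<bar>c * ?V s x\<bar> \<le> c * K"
        using abs_log_pmean_le[OF eps u K s(2), of x] c by (simp add: abs_mult)
      ultimately have "\<bar>- c * ?V s x + e s * ?V' s x\<bar> \<le> c * K + B * (4 * K)" by linarith
      then have "\<bar>exp (e s * ?V s x) * (- c * ?V s x + e s * ?V' s x)\<bar> \<le> M"
        unfolding M_def abs_mult[of "exp _"] using exp_eV(1)[OF s(2,3), of x] by (intro mult_mono) auto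
      then show "\<bar>F' s x\<bar> \<le> M * \<nu> x"
        unfolding F'_def abs_mult[of _ "\<nu> x"] using \<nu>(2)[of x] by (simp add: mult_right_mono)
    next
      show "F' t \<in> borel_measurable lborel" unfolding F'_def by measurable
    qed (use prob_density_integrable[OF \<nu>(1)] in auto)
    define S1 where "S1 = (\<integral>x. exp (e t * ?V t x) * ?V t x * \<nu> x \<partial>lborel)"
    define S2 where "S2 = (\<integral>x. exp (e t * ?V t x) * ?V' t x * \<nu> x \<partial>lborel)"
    have "\<bar>exp (e t * ?V t x) * ?V t x\<bar> \<le> exp (B * K) * K" for x
      unfolding abs_mult[of "exp _"] using exp_eV(1)[OF t', of x] abs_log_pmean_le[OF eps u K t'(1), of x] by (intro mult_mono) auto
    then have int1: "integrable lborel (\<lambda>x. exp (e t * ?V t x) * ?V t x * \<nu> x)"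
      by (intro integrable_bounded_times_density[OF \<nu>(1)]) measurable
    have "\<bar>exp (e t * ?V t x) * ?V' t x\<bar> \<le> exp (B * K) * (2 * K / t)" for x
      unfolding abs_mult[of "exp _"] using exp_eV(1)[OF t', of x] abs_log_pmean_deriv_le[OF eps u K t'(1), of x] by (intro mult_mono) auto
    then have int2: "integrable lborel (\<lambda>x. exp (e t * ?V t x) * ?V' t x * \<nu> x)"
      by (intro integrable_bounded_times_density[OF \<nu>(1)]) measurable
    have "F' t x = e t * (exp (e t * ?V t x) * ?V' t x * \<nu> x) - c * (exp (e t * ?V t x) * ?V t x * \<nu> x)" for x
      by (simp add: F'_def algebra_simps)
    then have N': "(\<integral>x. F' t x \<partial>lborel) = e t * S2 - c * S1"
      using int1 int2 by (simp add: S1_def S2_def)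
    define g where "g x = (1 / (t * conv_gauss eps (\<lambda>y. exp (t * u y)) x)) *\<^sub>R grad_conv_gauss eps (\<lambda>y. exp (t * u y)) x" for x
    \<comment> \<open>The tilt is \<open>e t\<close> times the power mean, and the Hamilton--Jacobi
      inequality bounds its squared gradient by \<open>(e t)\<^sup>2 / eps\<close> times the
      \<alpha>-derivative.\<close>
    have "(\<integral>x. exp (e t * ?V t x) * (e t * ?V t x) * \<nu> x \<partial>lborel) - N t * ln (N t)
        \<le> 1 / (2 * \<beta>) * (\<integral>x. exp (e t * ?V t x) * ((e t)\<^sup>2 / eps * ?V' t x) * \<nu> x \<partial>lborel)"
      unfolding N_def
    proof (rule LSI_exp[OF \<nu> LSI \<beta> _ eV[OF t'], where g="\<lambda>x. e t *\<^sub>R g x" and C'="(e t)\<^sup>2 / eps * (2 * K / t)"])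
      show "GDERIV (\<lambda>x. e t * ?V t x) x :> e t *\<^sub>R g x" for x
        using GDERIV_mult[OF GDERIV_const GDERIV_log_pmean[OF eps u K t'(1)], of "e t" x] by (simp add: g_def)
      show "(norm (e t *\<^sub>R g x))\<^sup>2 \<le> (e t)\<^sup>2 / eps * ?V' t x" for x
        using mult_left_mono[OF norm_grad_log_pmean_le[OF eps u K t'(1), of x], of "(e t)\<^sup>2"] eps
        by (simp add: g_def[symmetric] power_mult_distrib field_simps)
      show "\<bar>(e t)\<^sup>2 / eps * ?V' t x\<bar> \<le> (e t)\<^sup>2 / eps * (2 * K / t)" for x
        unfolding abs_mult using abs_log_pmean_deriv_le[OF eps u K t'(1), of x] eps by (intro mult_mono) auto
    qed measurable
    also have "(\<integral>x. exp (e t * ?V t x) * (e t * ?V t x) * \<nu> x \<partial>lborel) = e t * S1"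
      unfolding S1_def by (simp add: mult_ac flip: integral_mult_right_zero)
    also have "(\<integral>x. exp (e t * ?V t x) * ((e t)\<^sup>2 / eps * ?V' t x) * \<nu> x \<partial>lborel) = (e t)\<^sup>2 / eps * S2"
      unfolding S2_def by (simp add: mult_ac flip: integral_mult_right_zero)
    finally have "c * (e t * S1 - N t * ln (N t)) \<le> (e t)\<^sup>2 * S2"
      using \<beta> eps by (simp add: c_def field_simps)
    \<comment> \<open>Up to the positive factor \<open>N t * (e t * e t)\<close>, this is the
      derivative of \<open>ln (N t) / e t\<close>.\<close>
    then have key: "0 \<le> e t * (e t * S2 - c * S1) + c * (N t * ln (N t))"
      by (simp add: algebra_simps power2_eq_square)
    have de: "(e has_real_derivative - c) (at t)"
      unfolding e_def by (auto intro!: derivative_eq_intros)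
    have "((\<lambda>t. ln (N t) / e t) has_real_derivative
        (1 / N t * (e t * S2 - c * S1) * e t - ln (N t) * (- c)) / (e t * e t)) (at t)"
      using DERIV_divide[OF DERIV_chain2[OF DERIV_ln_divide[OF Npos[OF t']] dN[unfolded N']] de] e by simp
    moreover have "(1 / N t * (e t * S2 - c * S1) * e t - ln (N t) * (- c)) / (e t * e t)
        = (e t * (e t * S2 - c * S1) + c * (N t * ln (N t))) / (N t * (e t * e t))"
      using Npos[OF t'] e by (simp add: field_simps)
    ultimately show ?thesis using key Npos[OF t'] e by (auto intro!: exI divide_nonneg_pos)
  qed
  have "ln (N 1) / e 1 \<le> ln (N a) / e a"
    by (rule DERIV_nonneg_imp_nondecreasing[OF less_imp_le[OF a] mono])
  then have "N 1 powr (1 / e 1) \<le> N a powr (1 / e a)"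
    using Npos[of 1] Npos[of a] a by (simp add: powr_def)
  moreover have "e 1 = b" "e a = a" by (simp_all add: e_def b_def c_def)
  moreover have "exp (b * ?V 1 x) = conv_gauss eps (\<lambda>y. exp (u y)) x powr b" for x
    using conv_gauss_exp_pos[OF eps u K, of 1 x] by (simp add: log_pmean_def powr_def)
  moreover have "exp (a * ?V a x) = conv_gauss eps (\<lambda>y. exp (a * u y)) x" for x
    using conv_gauss_exp_pos[OF eps u K, of a x] a by (simp add: log_pmean_def)
  ultimately show ?thesis by (simp add: N_def)
qed

section \<open>Contraction of Renyi divergences\<close>

lemma gauss_2eps_le: "0 < eps \<Longrightarrow> gauss_2eps eps (y::'a::euclidean_space) \<le> gauss_2eps eps (0::'a)"
  by (simp add: gauss_2eps_def)

text \<open>The counterpart of \<open>integrable_conv_gauss\<close> for densities, which may be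
  unbounded: here the kernel is bounded by its value at the origin.\<close>

lemma integrable_conv_gauss':
  fixes f :: "'a::euclidean_space \<Rightarrow> real"
  assumes eps: "0 < eps" and f: "integrable lborel f"
  shows "integrable lborel (\<lambda>y. f y * gauss_2eps eps (x - y))"
proof (rule Bochner_Integration.integrable_bound)
  have [measurable]: "f \<in> borel_measurable lborel" using f by auto
  show "(\<lambda>y. f y * gauss_2eps eps (x - y)) \<in> borel_measurable lborel" by measurable
  show "integrable lborel (\<lambda>y. f y * gauss_2eps eps (0::'a))" using f by simp
  show "AE y in lborel. norm (f y * gauss_2eps eps (x - y)) \<le> norm (f y * gauss_2eps eps (0::'a))"
    unfolding norm_mult
    by (intro AE_I2 mult_left_mono) (simp_all add: gauss_2eps_le[OF eps] gauss_2eps_pos[OF eps] abs_of_pos)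
qed

lemma conv_gauss_nonneg: "0 < eps \<Longrightarrow> (\<And>y. 0 \<le> f y) \<Longrightarrow> 0 \<le> conv_gauss eps f x"
  unfolding conv_gauss_def by (intro integral_nonneg_AE AE_I2 mult_nonneg_nonneg) (auto simp: gauss_2eps_pos less_imp_le)

text \<open>Tonelli and the evenness of the Gaussian make the kernel self-adjoint for Lebesgue
  measure, which moves the smoothing from a density to a test function.\<close>

lemma nn_integral_conv_gauss_duality:
  fixes f k :: "'a::euclidean_space \<Rightarrow> real"
  assumes eps: "0 < eps" and f: "integrable lborel f" "\<And>x. 0 \<le> f x"
    and k[measurable]: "k \<in> borel_measurable borel" and k_nonneg: "\<And>y. 0 \<le> k y" and k_le: "\<And>y. k y \<le> C"
  shows "(\<integral>\<^sup>+ y. ennreal (conv_gauss eps f y * k y) \<partial>lborel) = (\<integral>\<^sup>+ x. ennreal (f x * conv_gauss eps k x) \<partial>lborel)"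
proof -
  have [measurable]: "f \<in> borel_measurable borel" using borel_measurable_integrable[OF f(1)] by simp
  have g0: "0 \<le> gauss_2eps eps z" for z :: 'a using gauss_2eps_pos[OF eps, of z] by simp
  have k_abs: "\<bar>k y\<bar> \<le> C" for y using k_nonneg[of y] k_le[of y] by simp
  have 1: "ennreal (conv_gauss eps f y * k y) = (\<integral>\<^sup>+ x. ennreal (f x * gauss_2eps eps (y - x) * k y) \<partial>lborel)" for y
    by (subst nn_integral_eq_integral)
       (simp_all add: conv_gauss_def integrable_conv_gauss'[OF eps f(1)] f(2) g0 k_nonneg)
  have 2: "ennreal (f x * conv_gauss eps k x) = (\<integral>\<^sup>+ y. ennreal (f x * gauss_2eps eps (y - x) * k y) \<partial>lborel)" for x
  proof -
    have eq: "f x * gauss_2eps eps (y - x) * k y = f x * (k y * gauss_2eps eps (x - y))" for y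
      by (simp add: gauss_2eps_minus[of eps y x])
    show ?thesis unfolding eq
      by (subst nn_integral_eq_integral)
         (simp_all add: conv_gauss_def integrable_conv_gauss[OF eps k k_abs] f(2) g0 k_nonneg)
  qed
  show ?thesis unfolding 1 2
    by (rule lborel_pair.Fubini') measurable
qed

lemma prob_density_conv_gauss:
  assumes eps: "0 < eps" and \<rho>: "prob_density \<rho>"
  shows "prob_density (conv_gauss eps \<rho>)"
proof -
  have "(\<integral>\<^sup>+ y. ennreal (conv_gauss eps \<rho> y * 1) \<partial>lborel) = (\<integral>\<^sup>+ x. ennreal (\<rho> x * conv_gauss eps (\<lambda>_. 1) x) \<partial>lborel)"
    by (rule nn_integral_conv_gauss_duality[OF eps prob_density_integrable(1)[OF \<rho>], where C=1])
       (use \<rho> in \<open>auto simp: prob_density_def\<close>)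
  then show ?thesis
    using \<rho> conv_gauss_nonneg[OF eps] by (auto simp: prob_density_def conv_gauss_const[OF eps])
qed

text \<open>The kernel is strictly positive, so a zero of the convolution would force \<nu> to
  vanish almost everywhere, against its mass 1. Ratios of smoothed densities are thereby
  meaningful.\<close>

lemma conv_gauss_pos:
  assumes eps: "0 < eps" and \<nu>: "prob_density \<nu>"
  shows "0 < conv_gauss eps \<nu> x"
proof -
  have \<nu>0: "0 \<le> \<nu> y" for y using \<nu> by (simp add: prob_density_def)
  have "conv_gauss eps \<nu> x \<noteq> 0"
  proof
    assume "conv_gauss eps \<nu> x = 0"
    then have "AE y in lborel. \<nu> y * gauss_2eps eps (x - y) = 0"
      unfolding conv_gauss_def
      by (subst (asm) integral_nonneg_eq_0_iff_AE)
         (use integrable_conv_gauss'[OF eps prob_density_integrable(1)[OF \<nu>]] \<nu>0 in \<open>auto intro!: AE_I2 mult_nonneg_nonneg simp: gauss_2eps_pos[OF eps] less_imp_le\<close>)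
    then have "AE y in lborel. \<nu> y = 0"
      by eventually_elim (use gauss_2eps_pos[OF eps] in \<open>auto simp: less_le\<close>)
    then have "(\<integral>y. \<nu> y \<partial>lborel) = 0" by (rule integral_eq_zero_AE)
    then show False using prob_density_integrable(2)[OF \<nu>] by simp
  qed
  then show ?thesis using conv_gauss_nonneg[of eps \<nu> x, OF eps \<nu>0] by simp
qed

lemma integral_conv_gauss_duality:
  fixes f k :: "'a::euclidean_space \<Rightarrow> real"
  assumes eps: "0 < eps" and f: "prob_density f"
    and k[measurable]: "k \<in> borel_measurable borel" and k_nonneg: "\<And>y. 0 \<le> k y" and k_le: "\<And>y. k y \<le> C"
  shows "(\<integral>y. k y * conv_gauss eps f y \<partial>lborel) = (\<integral>x. conv_gauss eps k x * f x \<partial>lborel)"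
proof -
  have f0: "0 \<le> f x" for x using f by (simp add: prob_density_def)
  have [measurable]: "f \<in> borel_measurable borel" by (rule prob_density_measurable[OF f])
  show ?thesis
    using nn_integral_conv_gauss_duality[OF eps prob_density_integrable(1)[OF f] f0 k k_nonneg k_le]
      conv_gauss_nonneg[of eps f, OF eps f0] conv_gauss_nonneg[of eps k, OF eps k_nonneg] f0 k_nonneg
    by (simp add: integral_eq_nn_integral mult.commute)
qed

text \<open>Here \<open>c\<close> is a truncation of the density ratio of the two convolutions, and the duality is tested
  against \<open>c\<^sup>r\<^sup>-\<^sup>1\<close>.\<close>

lemma renyi_conv_gauss_truncated:
  fixes \<nu> \<rho> c :: "'a::euclidean_space \<Rightarrow> real"
  assumes eps: "0 < eps" and \<nu>: "prob_density \<nu>" "\<And>x. 0 < \<nu> x" and LSI: "LSI \<nu> \<beta>" and \<beta>: "0 < \<beta>"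
    and r: "1 < r" and \<rho>: "prob_density \<rho>"
    and int: "integrable lborel (\<lambda>x. \<rho> x powr r / \<nu> x powr (r - 1))"
    and \<delta>: "0 < \<delta>" and c[measurable]: "c \<in> borel_measurable borel"
    and c_bounds: "\<And>y. \<delta> \<le> c y" "\<And>y. c y \<le> m"
    and c_le: "\<And>y. (c y - \<delta>) * conv_gauss eps \<nu> y \<le> conv_gauss eps \<rho> y"
  shows "(\<integral>y. c y powr r * conv_gauss eps \<nu> y \<partial>lborel)
    \<le> ((\<integral>x. \<rho> x powr r / \<nu> x powr (r - 1) \<partial>lborel) powr (1 / (r + 2 * \<beta> * eps)) + \<delta>) powr r"
proof -
  note [measurable] = prob_density_measurable[OF \<nu>(1)] prob_density_measurable[OF \<rho>]
  define a where "a = r / (r - 1)"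
  have a: "1 < a" using r by (simp add: a_def)
  define b where "b = a + 2 * \<beta> * eps * (a - 1)"
  have ab: "a < b" using a \<beta> eps by (simp add: b_def)
  have b: "1 < b" using a ab by simp
  have ar: "a * (r - 1) = r" using r by (simp add: a_def)
  have "b * (r - 1) = a * (r - 1) + 2 * \<beta> * eps * (a * (r - 1) - (r - 1))"
    by (simp add: b_def algebra_simps)
  \<comment> \<open>This identity is the source of the exponent
    \<open>1 / (r + 2 * \<beta> * eps)\<close>.\<close>
  then have b_eq: "b * (r - 1) = r + 2 * \<beta> * eps" by (simp add: ar)
  have \<rho>0: "0 \<le> \<rho> x" for x using \<rho> by (simp add: prob_density_def)
  have cpos: "0 < c y" for y using \<delta> c_bounds(1)[of y] by linarith
  have \<nu>1: "prob_density (conv_gauss eps \<nu>)" and \<rho>1: "prob_density (conv_gauss eps \<rho>)"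
    using prob_density_conv_gauss[OF eps] \<nu> \<rho> by auto
  have \<nu>1_pos: "0 < conv_gauss eps \<nu> y" for y by (rule conv_gauss_pos[OF eps \<nu>(1)])
  \<comment> \<open>Then \<open>exp (u y)\<close> is the test function
    \<open>c y powr (r - 1)\<close> and \<open>exp (a * u y)\<close> is \<open>c y powr r\<close>.
    The two-sided truncation of \<open>c\<close> makes \<open>u\<close> bounded, as
    hypercontractivity requires.\<close>
  define u where "u y = (r - 1) * ln (c y)" for y
  have u[measurable]: "u \<in> borel_measurable borel" unfolding u_def by measurable
  have u_le: "\<bar>u y\<bar> \<le> (r - 1) * (\<bar>ln \<delta>\<bar> + \<bar>ln m\<bar>)" for y
  proof -
    have "ln \<delta> \<le> ln (c y)" "ln (c y) \<le> ln m"
      using \<delta> cpos[of y] c_bounds[of y] by (auto intro!: ln_mono)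
    then have "\<bar>ln (c y)\<bar> \<le> \<bar>ln \<delta>\<bar> + \<bar>ln m\<bar>" by linarith
    then show ?thesis using r by (simp add: u_def abs_mult)
  qed
  have k_eq: "exp (u y) = c y powr (r - 1)" and ka_eq: "exp (a * u y) = c y powr r" for y
    using cpos[of y] ar by (auto simp: u_def powr_def simp flip: mult.assoc)
  have k_le: "c y powr s \<le> m powr s" if "0 \<le> s" for y s
    using cpos[of y] c_bounds(2)[of y] that by (intro powr_mono2) auto
  define k where "k y = c y powr (r - 1)" for y
  have k[measurable]: "k \<in> borel_measurable borel" unfolding k_def by measurable
  have k_bounds: "0 \<le> k y" "k y \<le> m powr (r - 1)" for y
    using k_le[of "r - 1" y] r by (auto simp: k_def)
  define Q where "Q = (\<integral>y. c y powr r * conv_gauss eps \<nu> y \<partial>lborel)"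
  define J where "J = (\<integral>x. \<rho> x powr r / \<nu> x powr (r - 1) \<partial>lborel)"
  have intQ: "integrable lborel (\<lambda>y. c y powr r * conv_gauss eps \<nu> y)"
    by (rule integrable_bounded_times_density[OF \<nu>1, where C="m powr r"]) (use k_le[of r] r in auto)
  have intk: "integrable lborel (\<lambda>y. k y * conv_gauss eps \<nu> y)"
    by (rule integrable_bounded_times_density[OF \<nu>1, where C="m powr (r - 1)"]) (use k_bounds in auto)
  have Q: "0 < Q" unfolding Q_def
    by (rule integral_pos_times_density[OF \<nu>1 intQ, of "\<delta> powr r"]) (use \<delta> c_bounds r in \<open>auto intro: powr_mono2\<close>)

  have Pk: "0 \<le> conv_gauss eps k x" "conv_gauss eps k x \<le> m powr (r - 1)" for x
    using conv_gauss_nonneg[of eps k, OF eps k_bounds(1)]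
      conv_gauss_mono[OF eps k _ _ _ k_bounds(2), of "m powr (r - 1)" "m powr (r - 1)" x] k_bounds
    by (auto simp: conv_gauss_const[OF eps])
  have "Q = (\<integral>x. conv_gauss eps (\<lambda>y. c y powr r) x * \<nu> x \<partial>lborel)"
    unfolding Q_def by (rule integral_conv_gauss_duality[OF eps \<nu>(1), where C="m powr r"]) (use k_le[of r] r in auto)
  with hypercontractivity_gauss[OF eps \<nu> LSI \<beta> u u_le a]
  have hyper: "(\<integral>x. conv_gauss eps k x powr b * \<nu> x \<partial>lborel) powr (1 / b) \<le> Q powr (1 / a)"
    by (simp add: k_eq ka_eq b_def k_def[abs_def])

  \<comment> \<open>\<open>p\<close> is conjugate to \<open>b\<close> and lies strictly between 1
    and \<open>r\<close>. Since p = \<theta> r + (1 - \<theta>), the integral of order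
    \<open>p\<close> is interpolated between that of order \<open>r\<close> and the total mass of
    \<rho>.\<close>
  define p where "p = b / (b - 1)"
  define \<theta> where "\<theta> = (p - 1) / (r - 1)"
  have p: "1 < p" using b by (simp add: p_def)
  have "1 < (b - 1) * (r - 1)" using b_eq \<beta> eps by (simp add: algebra_simps)
  moreover have \<theta>_eq: "\<theta> = 1 / ((b - 1) * (r - 1))" using b r by (simp add: \<theta>_def p_def field_simps)
  ultimately have \<theta>: "0 < \<theta>" "\<theta> < 1" by simp_all
  have pow_eq: "(\<rho> x powr r / \<nu> x powr (r - 1)) powr \<theta> * \<rho> x powr (1 - \<theta>) = \<rho> x powr p / \<nu> x powr (p - 1)" for x
  proof -
    have "(r - 1) * \<theta> = p - 1" using r by (simp add: \<theta>_def)
    moreover from this have "r * \<theta> + (1 - \<theta>) = p" by (simp add: algebra_simps)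
    ultimately show ?thesis
      by (simp add: powr_divide powr_powr powr_add[symmetric])
  qed
  note H = Holder_integral[OF \<theta> int _ prob_density_integrable(1)[OF \<rho>] \<rho>0, unfolded pow_eq prob_density_integrable(2)[OF \<rho>]]
  have intp: "integrable lborel (\<lambda>x. \<rho> x powr p / \<nu> x powr (p - 1))"
    and Jp: "(\<integral>x. \<rho> x powr p / \<nu> x powr (p - 1) \<partial>lborel) \<le> J powr \<theta>"
    using H by (auto simp: J_def)

  have "0 < 1 / b" "1 / b < 1" using b by auto
  note b' = this
  have intb: "integrable lborel (\<lambda>x. conv_gauss eps k x powr b * \<nu> x)"
    by (rule integrable_bounded_times_density[OF \<nu>(1), where C="(m powr (r - 1)) powr b"])
       (use Pk b in \<open>auto intro!: powr_mono2\<close>)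
  \<comment> \<open>Hoelder with the conjugate exponents \<open>b\<close> and \<open>p\<close>: the
    powers of \<nu> in the two factors cancel.\<close>
  have pow_eq': "(conv_gauss eps k x powr b * \<nu> x) powr (1 / b) * (\<rho> x powr p / \<nu> x powr (p - 1)) powr (1 - 1 / b)
      = conv_gauss eps k x * \<rho> x" for x
  proof -
    have e: "p * (1 - 1 / b) = 1" "(p - 1) * (1 - 1 / b) = 1 / b" using b by (auto simp: p_def field_simps)
    show ?thesis using b \<nu>(2)[of x] Pk(1)[of x] \<rho>0[of x]
      by (simp only: powr_mult powr_divide powr_powr e) simp
  qed
  have "(\<integral>x. conv_gauss eps k x * \<rho> x \<partial>lborel)
      \<le> (\<integral>x. conv_gauss eps k x powr b * \<nu> x \<partial>lborel) powr (1 / b) * (\<integral>x. \<rho> x powr p / \<nu> x powr (p - 1) \<partial>lborel) powr (1 - 1 / b)"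
    using Holder_integral(2)[OF b' intb _ intp] \<nu>(2) by (simp add: pow_eq' less_imp_le)
  also have "\<dots> \<le> Q powr (1 / a) * (J powr \<theta>) powr (1 - 1 / b)"
    using hyper Jp b' by (intro mult_mono powr_mono2 integral_nonneg_AE) auto
  also have "(J powr \<theta>) powr (1 - 1 / b) = J powr (1 / (r + 2 * \<beta> * eps))"
  proof -
    have "1 - 1 / b = (b - 1) / b" using b by (simp add: field_simps)
    then have "\<theta> * (1 - 1 / b) = 1 / (b * (r - 1))" using b r by (simp add: \<theta>_eq)
    then show ?thesis by (simp add: powr_powr b_eq)
  qed
  also have "(\<integral>x. conv_gauss eps k x * \<rho> x \<partial>lborel) = (\<integral>y. k y * conv_gauss eps \<rho> y \<partial>lborel)"
    by (rule integral_conv_gauss_duality[OF eps \<rho> k k_bounds, symmetric])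
  finally have upper: "(\<integral>y. k y * conv_gauss eps \<rho> y \<partial>lborel) \<le> Q powr (1 / a) * J powr (1 / (r + 2 * \<beta> * eps))" .

  \<comment> \<open>Matching lower bound: \<open>c - \<delta>\<close> lies below the ratio of the
    smoothed densities, and subtracting \<delta> costs a term that is controlled next.\<close>
  have "Q - \<delta> * (\<integral>y. k y * conv_gauss eps \<nu> y \<partial>lborel) = (\<integral>y. c y powr r * conv_gauss eps \<nu> y - \<delta> * (k y * conv_gauss eps \<nu> y) \<partial>lborel)"
    using intQ intk by (simp add: Q_def)
  also have "\<dots> \<le> (\<integral>y. k y * conv_gauss eps \<rho> y \<partial>lborel)"
  proof (rule integral_mono)
    show "integrable lborel (\<lambda>y. k y * conv_gauss eps \<rho> y)"
      by (rule integrable_bounded_times_density[OF \<rho>1, where C="m powr (r - 1)"]) (use k_bounds in auto)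
    fix y
    have "c y powr r = k y * c y"
      using cpos[of y] powr_add[of "c y" "r - 1" 1] by (simp add: k_def)
    then have "c y powr r * conv_gauss eps \<nu> y - \<delta> * (k y * conv_gauss eps \<nu> y) = k y * ((c y - \<delta>) * conv_gauss eps \<nu> y)"
      by (simp add: algebra_simps)
    also have "\<dots> \<le> k y * conv_gauss eps \<rho> y" using c_le k_bounds by (intro mult_left_mono) auto
    finally show "c y powr r * conv_gauss eps \<nu> y - \<delta> * (k y * conv_gauss eps \<nu> y) \<le> k y * conv_gauss eps \<rho> y" .
  qed (use intQ intk in auto)
  finally have lower: "Q - \<delta> * (\<integral>y. k y * conv_gauss eps \<nu> y \<partial>lborel) \<le> (\<integral>y. k y * conv_gauss eps \<rho> y \<partial>lborel)" .

  have a': "0 < 1 / a" "1 / a < 1" using a by auto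
  have pow_eq'': "(c y powr r * conv_gauss eps \<nu> y) powr (1 / a) * conv_gauss eps \<nu> y powr (1 - 1 / a) = k y * conv_gauss eps \<nu> y" for y
  proof -
    have "r * (1 / a) = r - 1" using r by (simp add: a_def)
    then show ?thesis using \<nu>1_pos[of y] 
      by (simp only: powr_mult powr_powr k_def mult.assoc flip: powr_add) simp
  qed
  \<comment> \<open>Hoelder against the smoothed \<nu>, whose mass is 1, bounds the cost of the
    shift by the same power of \<open>Q\<close>.\<close>
  have "(\<integral>y. k y * conv_gauss eps \<nu> y \<partial>lborel) \<le> Q powr (1 / a)"
    using Holder_integral(2)[OF a' intQ _ prob_density_integrable(1)[OF \<nu>1]] \<nu>1_pos
    by (simp add: pow_eq'' less_imp_le Q_def prob_density_integrable(2)[OF \<nu>1])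
  then have "\<delta> * (\<integral>y. k y * conv_gauss eps \<nu> y \<partial>lborel) \<le> \<delta> * Q powr (1 / a)" using \<delta> by simp
  with lower upper have "Q \<le> Q powr (1 / a) * (J powr (1 / (r + 2 * \<beta> * eps)) + \<delta>)"
    by (simp add: algebra_simps)
  moreover have "Q = Q powr (1 / a) * Q powr (1 / r)"
  proof -
    have "1 / a + 1 / r = 1" using r by (simp add: a_def field_simps)
    then show ?thesis using Q by (simp flip: powr_add)
  qed
  \<comment> \<open>\<open>Q\<close> occurs on both sides; the truncation makes it finite and
    positive, so its power \<open>1 / a\<close> cancels.\<close>
  ultimately have "Q powr (1 / r) \<le> J powr (1 / (r + 2 * \<beta> * eps)) + \<delta>"
    using Q by (metis mult_le_cancel_left_pos powr_gt_zero less_irrefl)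
  then have "(Q powr (1 / r)) powr r \<le> (J powr (1 / (r + 2 * \<beta> * eps)) + \<delta>) powr r"
    using r by (intro powr_mono2) auto
  then show ?thesis using Q r by (simp add: powr_powr Q_def[symmetric] J_def[symmetric])
qed

text \<open>Fatou's lemma removes the truncation: the truncated ratios converge pointwise to the
  true one and their bounds converge as \<delta> tends to 0.\<close>

lemma renyi_conv_gauss_contract:
  fixes \<nu> \<rho> :: "'a::euclidean_space \<Rightarrow> real"
  assumes eps: "0 < eps" and \<nu>: "prob_density \<nu>" "\<And>x. 0 < \<nu> x" and LSI: "LSI \<nu> \<beta>" and \<beta>: "0 < \<beta>"
    and r: "1 < r" and \<rho>: "prob_density \<rho>"
    and int: "integrable lborel (\<lambda>x. \<rho> x powr r / \<nu> x powr (r - 1))"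
  shows "(\<integral>\<^sup>+ y. ennreal ((conv_gauss eps \<rho> y / conv_gauss eps \<nu> y) powr r * conv_gauss eps \<nu> y) \<partial>lborel)
    \<le> ennreal ((\<integral>x. \<rho> x powr r / \<nu> x powr (r - 1) \<partial>lborel) powr (r / (r + 2 * \<beta> * eps)))"
proof -
  note [measurable] = prob_density_measurable[OF \<nu>(1)] prob_density_measurable[OF \<rho>]
  have \<nu>1: "prob_density (conv_gauss eps \<nu>)" using prob_density_conv_gauss[OF eps \<nu>(1)] .
  have \<nu>1_pos: "0 < conv_gauss eps \<nu> y" for y by (rule conv_gauss_pos[OF eps \<nu>(1)])
  have \<rho>1: "0 \<le> conv_gauss eps \<rho> y" for y
    using prob_density_conv_gauss[OF eps \<rho>] by (simp add: prob_density_def)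
  define R where "R = (\<integral>x. \<rho> x powr r / \<nu> x powr (r - 1) \<partial>lborel) powr (1 / (r + 2 * \<beta> * eps))"
  define h where "h y = conv_gauss eps \<rho> y / conv_gauss eps \<nu> y" for y
  have h[measurable]: "h \<in> borel_measurable borel" unfolding h_def by measurable
  have h0: "0 \<le> h y" for y using \<rho>1[of y] \<nu>1_pos[of y] by (simp add: h_def)
  define \<delta> where "\<delta> n = inverse (real (Suc n))" for n
  have \<delta>: "0 < \<delta> n" "\<delta> n \<le> 1" for n by (auto simp: \<delta>_def field_simps)
  have \<delta>_lim: "\<delta> \<longlonglongrightarrow> 0" unfolding \<delta>_def by (rule LIMSEQ_inverse_real_of_nat)
  define c where "c n y = max (\<delta> n) (min (h y) (real (Suc n)))" for n y
  have c[measurable]: "c n \<in> borel_measurable borel" for n unfolding c_def by measurable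
  have c_bounds: "\<delta> n \<le> c n y" "c n y \<le> real (Suc n)" for n y
    using \<delta>[of n] by (auto simp: c_def)
  have c0: "0 \<le> c n y" for n y using c_bounds(1)[of n y] \<delta>(1)[of n] by linarith
  have c_le: "(c n y - \<delta> n) * conv_gauss eps \<nu> y \<le> conv_gauss eps \<rho> y" for n y
  proof -
    have "c n y - \<delta> n \<le> h y" using h0[of y] \<delta>[of n] by (auto simp: c_def)
    then show ?thesis using \<nu>1_pos[of y] by (simp add: h_def field_simps)
  qed
  have "(\<lambda>n. c n y) \<longlonglongrightarrow> h y" for y
  proof -
    obtain n0 where "h y < real n0" using reals_Archimedean2 by blast
    then have "\<forall>\<^sub>F n in sequentially. max (\<delta> n) (h y) = c n y"
      by (auto simp: c_def eventually_sequentially intro!: exI[of _ n0])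
    moreover have "(\<lambda>n. max (\<delta> n) (h y)) \<longlonglongrightarrow> max 0 (h y)"
      by (intro tendsto_intros \<delta>_lim)
    ultimately show ?thesis using h0[of y] by (simp add: tendsto_cong max_absorb2)
  qed
  then have lim: "(\<lambda>n. ennreal (c n y powr r * conv_gauss eps \<nu> y)) \<longlonglongrightarrow> ennreal (h y powr r * conv_gauss eps \<nu> y)" for y
    using r c0 by (intro tendsto_ennrealI tendsto_mult_right tendsto_powr2 tendsto_const always_eventually) auto
  have "(\<integral>\<^sup>+ y. ennreal (h y powr r * conv_gauss eps \<nu> y) \<partial>lborel)
      = (\<integral>\<^sup>+ y. liminf (\<lambda>n. ennreal (c n y powr r * conv_gauss eps \<nu> y)) \<partial>lborel)"
    by (intro nn_integral_cong lim_imp_Liminf[symmetric] lim) simp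
  also have "\<dots> \<le> liminf (\<lambda>n. \<integral>\<^sup>+ y. ennreal (c n y powr r * conv_gauss eps \<nu> y) \<partial>lborel)"
    by (rule nn_integral_liminf) measurable
  also have "\<dots> \<le> liminf (\<lambda>n. ennreal ((R + \<delta> n) powr r))"
  proof (intro Liminf_mono always_eventually allI)
    fix n
    have cr: "c n y powr r \<le> real (Suc n) powr r" for y
      using c_bounds[of n y] \<delta>(1)[of n] r by (intro powr_mono2) auto
    have "integrable lborel (\<lambda>y. c n y powr r * conv_gauss eps \<nu> y)"
      by (rule integrable_bounded_times_density[OF \<nu>1, where C="real (Suc n) powr r"]) (use cr in auto)
    then have "(\<integral>\<^sup>+ y. ennreal (c n y powr r * conv_gauss eps \<nu> y) \<partial>lborel) = ennreal (\<integral>y. c n y powr r * conv_gauss eps \<nu> y \<partial>lborel)"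
      by (rule nn_integral_eq_integral) (use \<nu>1_pos in \<open>auto simp: less_imp_le\<close>)
    also have "\<dots> \<le> ennreal ((R + \<delta> n) powr r)"
      unfolding R_def
      by (intro ennreal_leI renyi_conv_gauss_truncated[OF eps \<nu> LSI \<beta> r \<rho> int \<delta>(1) c c_bounds c_le])
    finally show "(\<integral>\<^sup>+ y. ennreal (c n y powr r * conv_gauss eps \<nu> y) \<partial>lborel) \<le> ennreal ((R + \<delta> n) powr r)" .
  qed
  also have "\<dots> = ennreal ((R + 0) powr r)"
    using r \<delta>(1)
    by (intro lim_imp_Liminf tendsto_ennrealI tendsto_powr2 tendsto_add tendsto_const \<delta>_lim always_eventually allI)
       (auto simp: R_def less_imp_le)
  also have "(R + 0) powr r = (\<integral>x. \<rho> x powr r / \<nu> x powr (r - 1) \<partial>lborel) powr (r / (r + 2 * \<beta> * eps))"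
    by (simp add: R_def powr_powr)
  finally show ?thesis by (simp add: h_def)
qed

section \<open>The proximal map, push-forwards and a single PLA step\<close>

lemma prox_map_properties:
  fixes g :: "'a::euclidean_space \<Rightarrow> 'a"
  assumes lip: "\<And>x y. norm (g x - g y) \<le> L * norm (x - y)" and eps: "0 < eps" "eps * L < 1" and L: "0 \<le> L"
  shows "prox_map eps g y + eps *\<^sub>R g (prox_map eps g y) = y"
    and "prox_map eps g \<in> borel_measurable borel"
    and "(\<lambda>x. x + eps *\<^sub>R g x) \<in> borel_measurable borel"
proof -
  let ?S = "\<lambda>x. x + eps *\<^sub>R g x"
  have eg: "norm (eps *\<^sub>R g x - eps *\<^sub>R g y) \<le> eps * L * norm (x - y)" for x y
    using mult_left_mono[OF lip[of x y], of eps] eps by (simp flip: scaleR_diff_right)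
  have "\<exists>x. ?S x = y" for y
  proof -
    \<comment> \<open>Solving the implicit step for \<open>x\<close> is a fixed-point problem,
      contractive because \<open>eps * L < 1\<close>.\<close>
    have "\<exists>!x. y - eps *\<^sub>R g x = x"
    proof (rule banach_fix_type)
      show "0 \<le> eps * L" "eps * L < 1" using eps L by auto
      show "\<forall>x z. dist (y - eps *\<^sub>R g x) (y - eps *\<^sub>R g z) \<le> eps * L * dist x z"
        using eg by (simp add: dist_norm norm_minus_commute)
    qed
    then show ?thesis by (metis diff_add_cancel)
  qed
  \<comment> \<open>\<open>prox_map\<close> is built with the choice-based \<open>inv\<close>, which
    surjectivity turns into a right inverse.\<close>
  then have "surj ?S" by (metis surjI)
  then show S: "prox_map eps g y + eps *\<^sub>R g (prox_map eps g y) = y" for y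
    unfolding prox_map_def by (rule surj_f_inv_f)
  have cont: "continuous_on UNIV g"
    by (rule lipschitz_on_continuous_on[of L]) (use lip L in \<open>auto simp: lipschitz_on_def dist_norm\<close>)
  show "?S \<in> borel_measurable borel"
    by (intro borel_measurable_continuous_onI continuous_intros cont)
  have "norm (prox_map eps g x - prox_map eps g y) \<le> 1 / (1 - eps * L) * norm (x - y)" for x y
  proof -
    let ?x = "prox_map eps g x" and ?y = "prox_map eps g y"
    \<comment> \<open>Subtracting the two implicit equations lets the gradient difference be
      absorbed on the left, so the proximal map is Lipschitz and hence Borel.\<close>
    have "?x - ?y = (x - y) - (eps *\<^sub>R g ?x - eps *\<^sub>R g ?y)"
      using S[of x] S[of y] by (metis add_diff_add add_diff_cancel_right')
    then have "norm (?x - ?y) \<le> norm (x - y) + norm (eps *\<^sub>R g ?x - eps *\<^sub>R g ?y)"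
      by (metis norm_triangle_ineq4)
    with eg[of ?x ?y] have "norm (?x - ?y) \<le> norm (x - y) + eps * L * norm (?x - ?y)" by linarith
    then show ?thesis using eps by (simp add: field_simps)
  qed
  then have "continuous_on UNIV (prox_map eps g)"
    using eps by (intro lipschitz_on_continuous_on[of "1 / (1 - eps * L)"]) (auto simp: lipschitz_on_def dist_norm)
  then show "prox_map eps g \<in> borel_measurable borel"
    by (rule borel_measurable_continuous_onI)
qed

text \<open>The left inverse \<open>S\<close> transports density ratios: after the push-forward the
  ratio is almost everywhere the old one composed with \<open>S\<close>. Working with the measures
  themselves avoids Jacobians, which would cancel in the ratio.\<close>

lemma nn_integral_renyi_pushforward:
  fixes \<nu> \<nu>' \<rho> \<rho>' :: "'a::euclidean_space \<Rightarrow> real"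
  assumes T[measurable]: "T \<in> borel_measurable borel" and S[measurable]: "S \<in> borel_measurable borel"
    and ST: "\<And>y. S (T y) = y"
    and \<nu>: "prob_density \<nu>" "\<And>y. 0 < \<nu> y" and \<rho>: "prob_density \<rho>"
    and \<nu>': "prob_density \<nu>'" "\<And>y. 0 < \<nu>' y" and \<rho>': "prob_density \<rho>'"
    and push_\<nu>: "density lborel (\<lambda>x. ennreal (\<nu>' x)) = distr (density lborel (\<lambda>y. ennreal (\<nu> y))) lborel T"
    and push_\<rho>: "density lborel (\<lambda>x. ennreal (\<rho>' x)) = distr (density lborel (\<lambda>y. ennreal (\<rho> y))) lborel T"
  shows "(\<integral>\<^sup>+ x. ennreal (\<rho>' x powr r / \<nu>' x powr (r - 1)) \<partial>lborel)
    = (\<integral>\<^sup>+ y. ennreal ((\<rho> y / \<nu> y) powr r * \<nu> y) \<partial>lborel)"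
proof -
  note [measurable] = prob_density_measurable[OF \<nu>(1)] prob_density_measurable[OF \<rho>]
    prob_density_measurable[OF \<nu>'(1)] prob_density_measurable[OF \<rho>']
  have nn: "0 \<le> \<rho> y" "0 \<le> \<rho>' y" for y using \<rho> \<rho>' by (auto simp: prob_density_def)
  define h where "h y = \<rho> y / \<nu> y" for y
  have h[measurable]: "h \<in> borel_measurable borel" unfolding h_def by measurable
  have h0: "0 \<le> h y" for y using nn(1)[of y] \<nu>(2)[of y] by (simp add: h_def)
  have "density lborel (\<lambda>x. ennreal (\<nu>' x) * ennreal (h (S x)))
      = density (density lborel (\<lambda>x. ennreal (\<nu>' x))) (\<lambda>x. ennreal (h (S x)))"
    by (rule density_density_eq[symmetric]) measurable
  also have "\<dots> = distr (density (density lborel (\<lambda>y. ennreal (\<nu> y))) (\<lambda>y. ennreal (h (S (T y))))) lborel T"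
    unfolding push_\<nu> by (rule density_distr) measurable
  also have "density (density lborel (\<lambda>y. ennreal (\<nu> y))) (\<lambda>y. ennreal (h (S (T y))))
      = density lborel (\<lambda>y. ennreal (\<nu> y) * ennreal (h y))"
    unfolding ST by (rule density_density_eq) measurable
  also have "(\<lambda>y. ennreal (\<nu> y) * ennreal (h y)) = (\<lambda>y. ennreal (\<rho> y))"
  proof
    show "ennreal (\<nu> y) * ennreal (h y) = ennreal (\<rho> y)" for y
      using \<nu>(2)[of y] h0[of y] by (simp add: h_def flip: ennreal_mult')
  qed
  also have "distr (density lborel (\<lambda>y. ennreal (\<rho> y))) lborel T = density lborel (\<lambda>x. ennreal (\<rho>' x))"
    by (rule push_\<rho>[symmetric])
  finally have "AE x in lborel. ennreal (\<nu>' x) * ennreal (h (S x)) = ennreal (\<rho>' x)"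
    by (subst (asm) sigma_finite_measure.density_unique_iff[OF sigma_finite_lborel]) measurable
  then have "AE x in lborel. \<rho>' x = \<nu>' x * h (S x)"
    by eventually_elim (use nn \<nu>'(2) h0 in \<open>simp add: ennreal_inj less_imp_le flip: ennreal_mult\<close>)
  then have "AE x in lborel. ennreal (\<rho>' x powr r / \<nu>' x powr (r - 1)) = ennreal (\<nu>' x) * ennreal (h (S x) powr r)"
  proof eventually_elim
    fix x assume eq: "\<rho>' x = \<nu>' x * h (S x)"
    have "\<nu>' x powr r / \<nu>' x powr (r - 1) = \<nu>' x" using \<nu>'(2)[of x] by (simp flip: powr_diff)
    moreover have "\<rho>' x powr r / \<nu>' x powr (r - 1) = \<nu>' x powr r / \<nu>' x powr (r - 1) * h (S x) powr r"
      unfolding eq using \<nu>'(2)[of x] h0[of "S x"] by (simp add: powr_mult)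
    ultimately have "\<rho>' x powr r / \<nu>' x powr (r - 1) = \<nu>' x * h (S x) powr r" by simp
    then show "ennreal (\<rho>' x powr r / \<nu>' x powr (r - 1)) = ennreal (\<nu>' x) * ennreal (h (S x) powr r)"
      using \<nu>'(2)[of x] by (simp flip: ennreal_mult')
  qed
  then have "(\<integral>\<^sup>+ x. ennreal (\<rho>' x powr r / \<nu>' x powr (r - 1)) \<partial>lborel)
      = (\<integral>\<^sup>+ x. ennreal (\<nu>' x) * ennreal (h (S x) powr r) \<partial>lborel)"
    by (rule nn_integral_cong_AE)
  also have "\<dots> = (\<integral>\<^sup>+ x. ennreal (h (S x) powr r) \<partial>density lborel (\<lambda>x. ennreal (\<nu>' x)))"
    by (rule nn_integral_density[symmetric]) measurable
  also have "\<dots> = (\<integral>\<^sup>+ y. ennreal (h (S (T y)) powr r) \<partial>density lborel (\<lambda>y. ennreal (\<nu> y)))"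
    unfolding push_\<nu> by (rule nn_integral_distr) measurable
  also have "\<dots> = (\<integral>\<^sup>+ y. ennreal (\<nu> y) * ennreal (h y powr r) \<partial>lborel)"
    unfolding ST by (rule nn_integral_density) measurable
  also have "\<dots> = (\<integral>\<^sup>+ y. ennreal ((\<rho> y / \<nu> y) powr r * \<nu> y) \<partial>lborel)"
    using \<nu>(2) by (intro nn_integral_cong) (simp add: h_def less_imp_le mult.commute flip: ennreal_mult')
  finally show ?thesis .
qed

text \<open>Nonnegativity of the divergence before taking logarithms, from Hoelder against the mass
  of \<nu>. It allows exponents of the integral to be enlarged and logarithms of it to be
  taken.\<close>

lemma renyi_integral_ge_1:
  fixes \<nu> \<rho> :: "'a::euclidean_space \<Rightarrow> real"
  assumes r: "1 < r" and \<nu>: "prob_density \<nu>" "\<And>x. 0 < \<nu> x" and \<rho>: "prob_density \<rho>"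
    and int: "integrable lborel (\<lambda>x. \<rho> x powr r / \<nu> x powr (r - 1))"
  shows "1 \<le> (\<integral>x. \<rho> x powr r / \<nu> x powr (r - 1) \<partial>lborel)" (is "1 \<le> ?J")
proof -
  have \<rho>0: "0 \<le> \<rho> x" for x using \<rho> by (simp add: prob_density_def)
  have \<theta>: "0 < 1 / r" "1 / r < 1" using r by auto
  have "(\<rho> x powr r / \<nu> x powr (r - 1)) powr (1 / r) * \<nu> x powr (1 - 1 / r) = \<rho> x" for x
  proof -
    have "(r - 1) * (1 / r) = 1 - 1 / r" using r by (simp add: field_simps)
    then show ?thesis using r \<nu>(2)[of x] \<rho>0[of x]
      by (simp only: powr_divide powr_powr) simp
  qed
  then have "1 \<le> ?J powr (1 / r)"
    using Holder_integral(2)[OF \<theta> int _ prob_density_integrable(1)[OF \<nu>(1)]] \<nu>(2)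
    by (simp add: prob_density_integrable(2)[OF \<nu>(1)] prob_density_integrable(2)[OF \<rho>] less_imp_le)
  then have "1 powr r \<le> (?J powr (1 / r)) powr r" using r by (intro powr_mono2) auto
  moreover have "0 \<le> ?J" by (intro integral_nonneg_AE) auto
  ultimately show ?thesis using r by (simp add: powr_powr)
qed

lemma renyi_eq_ln:
  fixes \<nu> \<rho> :: "'a::euclidean_space \<Rightarrow> real"
  assumes "integrable lborel (\<lambda>x. \<rho> x powr r / \<nu> x powr (r - 1))"
  shows "renyi r \<nu> \<rho> = ereal (1 / (r - 1) * ln (\<integral>x. \<rho> x powr r / \<nu> x powr (r - 1) \<partial>lborel))"
proof -
  have "(\<integral>\<^sup>+ x. ennreal (\<rho> x powr r / \<nu> x powr (r - 1)) \<partial>lborel) = ennreal (\<integral>x. \<rho> x powr r / \<nu> x powr (r - 1) \<partial>lborel)"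
    by (rule nn_integral_eq_integral[OF assms]) simp
  then show ?thesis by (simp add: renyi_def Let_def integral_nonneg_AE)
qed

lemma renyi_eq_infinity:
  fixes \<nu> \<rho> :: "'a::euclidean_space \<Rightarrow> real"
  assumes "1 < r" and [measurable]: "\<nu> \<in> borel_measurable borel" "\<rho> \<in> borel_measurable borel"
    and "\<not> integrable lborel (\<lambda>x. \<rho> x powr r / \<nu> x powr (r - 1))"
  shows "renyi r \<nu> \<rho> = \<infinity>"
proof -
  have "(\<integral>\<^sup>+ x. ennreal (\<rho> x powr r / \<nu> x powr (r - 1)) \<partial>lborel) = \<infinity>"
  proof (rule ccontr)
    assume "(\<integral>\<^sup>+ x. ennreal (\<rho> x powr r / \<nu> x powr (r - 1)) \<partial>lborel) \<noteq> \<infinity>"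
    then have "integrable lborel (\<lambda>x. \<rho> x powr r / \<nu> x powr (r - 1))"
      by (intro integrableI_nonneg) (auto simp: less_top)
    then show False using assms by simp
  qed
  then show ?thesis using assms(1) by (simp add: renyi_def)
qed

text \<open>Stationarity says that the proximal map carries the smoothed \<nu> back to \<nu>, so a
  step is the Gaussian contraction followed by a divergence-preserving push-forward.\<close>

lemma renyi_integral_PLA_step:
  fixes \<nu> \<rho> \<rho>' :: "'a::euclidean_space \<Rightarrow> real"
  assumes lip: "\<And>x y. norm (g x - g y) \<le> L * norm (x - y)" and L: "0 \<le> L" "eps * L < 1"
    and eps: "0 < eps" and \<nu>: "prob_density \<nu>" "\<And>x. 0 < \<nu> x" and LSI: "LSI \<nu> \<beta>" and \<beta>: "0 < \<beta>"
    and small: "2 * \<beta> * eps < 1" and stat: "PLA_step eps g \<nu> \<nu>"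
    and r: "1 < r" and \<rho>: "prob_density \<rho>" and \<rho>': "prob_density \<rho>'" and step: "PLA_step eps g \<rho> \<rho>'"
    and int: "integrable lborel (\<lambda>x. \<rho> x powr r / \<nu> x powr (r - 1))"
  shows "integrable lborel (\<lambda>x. \<rho>' x powr r / \<nu> x powr (r - 1))"
    and "(\<integral>x. \<rho>' x powr r / \<nu> x powr (r - 1) \<partial>lborel)
      \<le> (\<integral>x. \<rho> x powr r / \<nu> x powr (r - 1) \<partial>lborel) powr exp (- \<beta> * eps / r)"
proof -
  note [measurable] = prob_density_measurable[OF \<nu>(1)] prob_density_measurable[OF \<rho>']
  let ?J = "\<integral>x. \<rho> x powr r / \<nu> x powr (r - 1) \<partial>lborel"
  note prox = prox_map_properties[OF lip eps L(2,1)]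
  have "(\<integral>\<^sup>+ x. ennreal (\<rho>' x powr r / \<nu> x powr (r - 1)) \<partial>lborel)
      = (\<integral>\<^sup>+ y. ennreal ((conv_gauss eps \<rho> y / conv_gauss eps \<nu> y) powr r * conv_gauss eps \<nu> y) \<partial>lborel)"
    by (rule nn_integral_renyi_pushforward[OF prox(2,3,1) prob_density_conv_gauss[OF eps \<nu>(1)]
          conv_gauss_pos[OF eps \<nu>(1)] prob_density_conv_gauss[OF eps \<rho>] \<nu> \<rho>'
          stat[unfolded PLA_step_def] step[unfolded PLA_step_def]])
  also have "\<dots> \<le> ennreal (?J powr (r / (r + 2 * \<beta> * eps)))"
    by (rule renyi_conv_gauss_contract[OF eps \<nu> LSI \<beta> r \<rho> int])
  finally have le: "(\<integral>\<^sup>+ x. ennreal (\<rho>' x powr r / \<nu> x powr (r - 1)) \<partial>lborel) \<le> ennreal (?J powr (r / (r + 2 * \<beta> * eps)))" .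
  then show int': "integrable lborel (\<lambda>x. \<rho>' x powr r / \<nu> x powr (r - 1))"
    by (intro integrableI_nonneg) (auto intro: le_less_trans)
  have "ennreal (\<integral>x. \<rho>' x powr r / \<nu> x powr (r - 1) \<partial>lborel) \<le> ennreal (?J powr (r / (r + 2 * \<beta> * eps)))"
    using le by (subst (asm) nn_integral_eq_integral[OF int']) auto
  then have "(\<integral>x. \<rho>' x powr r / \<nu> x powr (r - 1) \<partial>lborel) \<le> ?J powr (r / (r + 2 * \<beta> * eps))"
    by (simp add: ennreal_le_iff)
  also have "\<dots> \<le> ?J powr exp (- \<beta> * eps / r)"
  proof (rule powr_mono)
    show "1 \<le> ?J" by (rule renyi_integral_ge_1[OF r \<nu> \<rho> int])
    \<comment> \<open>The factor is 1/(1 + 2y). On the unit interval exp y \<le> 1 + y + y^2 \<le> 1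
      + 2y, and the step-size condition \<open>2 * \<beta> * eps < 1\<close> gives
      \<open>y \<le> 1\<close>. With \<open>r = 2 * q\<close> this is the claimed rate per
      step.\<close>
    define y where "y = \<beta> * eps / r"
    have y: "0 \<le> y" "y \<le> 1"
      using \<beta> eps r small by (auto simp: y_def field_simps)
    have "exp y \<le> 1 + y + y\<^sup>2" by (rule exp_bound[OF y])
    also have "\<dots> \<le> 1 + 2 * y" using y by (simp add: power2_eq_square mult_left_le)
    finally have "inverse (1 + 2 * y) \<le> inverse (exp y)" by (rule le_imp_inverse_le) simp
    also have "inverse (1 + 2 * y) = r / (r + 2 * \<beta> * eps)"
      using r \<beta> eps by (simp add: y_def field_simps)
    finally show "r / (r + 2 * \<beta> * eps) \<le> exp (- \<beta> * eps / r)"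
      by (simp add: y_def exp_minus)
  qed
  finally show "(\<integral>x. \<rho>' x powr r / \<nu> x powr (r - 1) \<partial>lborel) \<le> ?J powr exp (- \<beta> * eps / r)" .
qed

section \<open>Iteration of the step and change of the reference measure\<close>

lemma renyi_PLA_contract:
  fixes \<nu> :: "'a::euclidean_space \<Rightarrow> real" and \<rho> :: "nat \<Rightarrow> 'a \<Rightarrow> real"
  assumes lip: "\<And>x y. norm (g x - g y) \<le> L * norm (x - y)" and L: "0 \<le> L" "eps * L < 1"
    and eps: "0 < eps" and \<nu>: "prob_density \<nu>" "\<And>x. 0 < \<nu> x" and LSI: "LSI \<nu> \<beta>" and \<beta>: "0 < \<beta>"
    and small: "2 * \<beta> * eps < 1" and stat: "PLA_step eps g \<nu> \<nu>"
    and r: "1 < r" and \<rho>: "\<And>k. prob_density (\<rho> k)" and step: "\<And>k. PLA_step eps g (\<rho> k) (\<rho> (Suc k))"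
    and int: "integrable lborel (\<lambda>x. \<rho> 0 x powr r / \<nu> x powr (r - 1))"
  shows "integrable lborel (\<lambda>x. \<rho> k x powr r / \<nu> x powr (r - 1)) \<and>
    (\<integral>x. \<rho> k x powr r / \<nu> x powr (r - 1) \<partial>lborel)
      \<le> (\<integral>x. \<rho> 0 x powr r / \<nu> x powr (r - 1) \<partial>lborel) powr exp (- \<beta> * eps * real k / r)"
proof (induction k)
  case 0
  then show ?case using int by (simp add: integral_nonneg_AE)
next
  case (Suc k)
  let ?J = "\<lambda>k. \<integral>x. \<rho> k x powr r / \<nu> x powr (r - 1) \<partial>lborel"
  note S = renyi_integral_PLA_step[OF lip L eps \<nu> LSI \<beta> small stat r \<rho> \<rho> step[of k] conjunct1[OF Suc]]
  have "?J (Suc k) \<le> ?J k powr exp (- \<beta> * eps / r)" by (rule S(2))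
  also have "\<dots> \<le> (?J 0 powr exp (- \<beta> * eps * real k / r)) powr exp (- \<beta> * eps / r)"
    using Suc by (intro powr_mono2) (auto simp: integral_nonneg_AE)
  also have "\<dots> = ?J 0 powr exp (- \<beta> * eps * real (Suc k) / r)"
    by (simp add: powr_powr algebra_simps add_divide_distrib diff_divide_distrib flip: exp_add)
  finally show ?case using S(1) by simp
qed

text \<open>Cauchy-Schwarz: the integrand of order \<open>q\<close> is the geometric mean of the
  integrands of orders \<open>2 * q\<close> (\<rho> against \<mu>) and \<open>2 * q - 1\<close>
  (\<mu> against \<nu>). As the left integral is at least 1, neither factor vanishes and logarithms
  may be taken.\<close>

lemma renyi_triangle:
  fixes \<nu> \<mu> \<rho> :: "'a::euclidean_space \<Rightarrow> real"
  assumes q: "1 < q" and \<nu>: "prob_density \<nu>" "\<And>x. 0 < \<nu> x" and \<mu>: "\<And>x. 0 < \<mu> x"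
    and \<rho>: "prob_density \<rho>"
    and int1: "integrable lborel (\<lambda>x. \<rho> x powr (2 * q) / \<mu> x powr (2 * q - 1))"
    and int2: "integrable lborel (\<lambda>x. \<mu> x powr (2 * q - 1) / \<nu> x powr (2 * q - 2))"
  shows "integrable lborel (\<lambda>x. \<rho> x powr q / \<nu> x powr (q - 1))"
    and "ln (\<integral>x. \<rho> x powr q / \<nu> x powr (q - 1) \<partial>lborel)
      \<le> (ln (\<integral>x. \<rho> x powr (2 * q) / \<mu> x powr (2 * q - 1) \<partial>lborel)
          + ln (\<integral>x. \<mu> x powr (2 * q - 1) / \<nu> x powr (2 * q - 2) \<partial>lborel)) / 2"
proof -
  let ?A = "\<integral>x. \<rho> x powr (2 * q) / \<mu> x powr (2 * q - 1) \<partial>lborel"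
  let ?B = "\<integral>x. \<mu> x powr (2 * q - 1) / \<nu> x powr (2 * q - 2) \<partial>lborel"
  let ?C = "\<integral>x. \<rho> x powr q / \<nu> x powr (q - 1) \<partial>lborel"
  have "(\<rho> x powr (2 * q) / \<mu> x powr (2 * q - 1)) powr (1 / 2) * (\<mu> x powr (2 * q - 1) / \<nu> x powr (2 * q - 2)) powr (1 - 1 / 2)
      = \<rho> x powr q / \<nu> x powr (q - 1)" for x
  proof -
    have e: "1 - 1 / 2 = (1 / 2 :: real)" "2 * q * (1 / 2) = q" "(2 * q - 2) * (1 / 2) = q - 1" by simp_all
    show ?thesis using \<mu>[of x] \<nu>(2)[of x] by (simp only: e powr_divide powr_powr powr_ge_zero) simp
  qed
  note H = Holder_integral[of "1/2", OF _ _ int1 _ int2, unfolded this]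
  show int: "integrable lborel (\<lambda>x. \<rho> x powr q / \<nu> x powr (q - 1))" by (rule H(1)) auto
  have C: "1 \<le> ?C" by (rule renyi_integral_ge_1[OF q \<nu> \<rho> int])
  have le: "?C \<le> ?A powr (1 / 2) * ?B powr (1 / 2)" using H(2) by simp
  have nn: "0 \<le> ?A" "0 \<le> ?B" by (intro integral_nonneg_AE; simp)+
  have "?A \<noteq> 0" "?B \<noteq> 0" using le C by auto
  with nn have pos: "0 < ?A" "0 < ?B" by (metis order_le_less)+
  have "ln ?C \<le> ln (?A powr (1 / 2) * ?B powr (1 / 2))" using le C by (intro ln_mono) auto
  also have "\<dots> = (ln ?A + ln ?B) / 2" using pos by (simp add: ln_mult ln_powr add_divide_distrib)
  finally show "ln ?C \<le> (ln ?A + ln ?B) / 2" .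
qed

theorem theorem2:
  fixes f :: "'a::euclidean_space \<Rightarrow> real"
    and gradf :: "'a \<Rightarrow> 'a"
    and H :: "'a \<Rightarrow> 'a \<Rightarrow> 'a"
    and L \<beta> \<epsilon> q :: real
    and \<nu>\<epsilon> :: "'a \<Rightarrow> real"
    and \<rho> :: "nat \<Rightarrow> 'a \<Rightarrow> real"
  assumes grad: "\<And>x. GDERIV f x :> gradf x"
    and hess: "\<And>x. (gradf has_derivative H x) (at x)"
    and hess_bound: "\<And>x. onorm (H x) \<le> L"
    and L_pos: "0 < L"
    and nu_prob: "prob_density (\<lambda>x. exp (- f x))"
    and beta_pos: "0 < \<beta>"
    and eps_pos: "0 < \<epsilon>"
    and eps_small: "\<epsilon> < min (1 / L) (1 / (2 * \<beta>))"
    and nueps_prob: "prob_density \<nu>\<epsilon>"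
    and nueps_pos: "\<And>x. 0 < \<nu>\<epsilon> x"
    and nueps_stat: "PLA_step \<epsilon> gradf \<nu>\<epsilon> \<nu>\<epsilon>"
    and nueps_LSI: "LSI \<nu>\<epsilon> \<beta>"
    and q_gt: "1 < q"
    and rho0: "prob_density (\<rho> 0)"
    and rho_step: "\<And>k. prob_density (\<rho> (Suc k)) \<and> PLA_step \<epsilon> gradf (\<rho> k) (\<rho> (Suc k))"
  shows "\<And>k. renyi q (\<lambda>x. exp (- f x)) (\<rho> k)
           \<le> ereal ((q - 1 / 2) / (q - 1)) * renyi (2 * q) \<nu>\<epsilon> (\<rho> 0)
               * ereal (exp (- \<beta> * \<epsilon> * real k / (2 * q)))
             + renyi (2 * q - 1) (\<lambda>x. exp (- f x)) \<nu>\<epsilon>"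
proof -
  fix k
  let ?\<nu> = "\<lambda>x. exp (- f x)"
  let ?E = "exp (- \<beta> * \<epsilon> * real k / (2 * q))"
  note meas = prob_density_measurable[OF nu_prob] prob_density_measurable[OF nueps_prob] prob_density_measurable[OF rho0]
  have rho: "prob_density (\<rho> k)" for k using rho0 rho_step by (cases k) auto
  \<comment> \<open>The first bound makes the implicit step a contraction, the second permits the
    exponential form of the rate.\<close>
  have "\<epsilon> * L < 1" "2 * \<beta> * \<epsilon> < 1" using eps_small L_pos beta_pos by (auto simp: field_simps)
  note small = this
  have lip: "norm (gradf x - gradf y) \<le> L * norm (x - y)" for x y
    by (rule differentiable_bound[of UNIV gradf H]) (use hess hess_bound in auto)
  have sub: "2 * q - 1 - 1 = 2 * q - 2" by simp
  show "renyi q ?\<nu> (\<rho> k) \<le> ereal ((q - 1 / 2) / (q - 1)) * renyi (2 * q) \<nu>\<epsilon> (\<rho> 0) * ereal ?E + renyi (2 * q - 1) ?\<nu> \<nu>\<epsilon>"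
  \<comment> \<open>If either divergence on the right is infinite, so is the right side; otherwise
    everything reduces to real logarithms.\<close>
  proof (cases "integrable lborel (\<lambda>x. \<rho> 0 x powr (2 * q) / \<nu>\<epsilon> x powr (2 * q - 1))")
    case False
    then have "renyi (2 * q) \<nu>\<epsilon> (\<rho> 0) = \<infinity>" using q_gt meas by (intro renyi_eq_infinity) auto
    then show ?thesis using q_gt by simp
  next
    case int0: True
    let ?J = "\<lambda>k. \<integral>x. \<rho> k x powr (2 * q) / \<nu>\<epsilon> x powr (2 * q - 1) \<partial>lborel"
    show ?thesis
    proof (cases "integrable lborel (\<lambda>x. \<nu>\<epsilon> x powr (2 * q - 1) / ?\<nu> x powr (2 * q - 2))")
      case False
      then have "renyi (2 * q - 1) ?\<nu> \<nu>\<epsilon> = \<infinity>" using q_gt meas by (intro renyi_eq_infinity) (auto simp: sub)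
      then show ?thesis by (simp add: renyi_eq_ln[OF int0])
    next
      case int2: True
      let ?B = "\<integral>x. \<nu>\<epsilon> x powr (2 * q - 1) / ?\<nu> x powr (2 * q - 2) \<partial>lborel"
      have r: "1 < 2 * q" using q_gt by simp
      have intk: "integrable lborel (\<lambda>x. \<rho> k x powr (2 * q) / \<nu>\<epsilon> x powr (2 * q - 1))"
        and Jk: "?J k \<le> ?J 0 powr ?E"
        using renyi_PLA_contract[where \<rho>=\<rho>, OF lip less_imp_le[OF L_pos] small(1) eps_pos nueps_prob nueps_pos nueps_LSI beta_pos
            small(2) nueps_stat r rho conjunct2[OF rho_step] int0, of k] by auto
      have "1 \<le> ?J k" "1 \<le> ?J 0"
        using renyi_integral_ge_1[OF r nueps_prob nueps_pos rho] intk int0 by auto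
      then have "ln (?J k) \<le> ?E * ln (?J 0)"
        using ln_mono[OF Jk] by (simp add: ln_powr)
      note tri = renyi_triangle[OF q_gt nu_prob _ nueps_pos rho intk int2]
      have "1 / (q - 1) * ln (\<integral>x. \<rho> k x powr q / ?\<nu> x powr (q - 1) \<partial>lborel) \<le> 1 / (q - 1) * ((ln (?J k) + ln ?B) / 2)"
        using tri(2) q_gt by (intro mult_left_mono) auto
      also have "\<dots> \<le> 1 / (q - 1) * ((?E * ln (?J 0) + ln ?B) / 2)"
        using \<open>ln (?J k) \<le> ?E * ln (?J 0)\<close> q_gt by (intro mult_left_mono) auto
      \<comment> \<open>The factor 1/2 from Cauchy-Schwarz and the normalisations of orders
        \<open>q\<close> and \<open>2 * q\<close> combine to the stated constant; for order
        \<open>2 * q - 1\<close> they match exactly, leaving coefficient 1.\<close>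
      also have "\<dots> = (q - 1 / 2) / (q - 1) * (1 / (2 * q - 1) * ln (?J 0)) * ?E + 1 / (2 * q - 1 - 1) * ln ?B"
      proof -
        have "(q - 1 / 2) / (q - 1) * (1 / (2 * q - 1)) = 1 / (2 * (q - 1))" "1 / (2 * q - 1 - 1) = 1 / (2 * (q - 1))"
          using q_gt by (auto simp: field_simps)
        then show ?thesis by (simp only: mult.assoc[symmetric]) (simp add: add_divide_distrib algebra_simps)
      qed
      finally show ?thesis
        using tri(1) int2 by (simp add: renyi_eq_ln[OF int0] renyi_eq_ln sub)
    qed
  qed
qed

end
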